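(* Let $\alpha,\beta,a,b,c,z,s\in\mathbb{C}$ with $\mathrm{Re}(\alpha)>-1$, $\mathrm{Re}(c)>\mathrm{Re}(b)>0$, $|\arg(1-z)|<\pi$ and $\mathrm{Re}(s)>0$. Then the Mellin transform with respect to $p$ of the $\Psi$-Gauss hypergeometric function is $$\mathcal{M}\left\lbrace {}^{\Psi}F_{p}^{(\alpha,\beta)}(a,b;c;z):s\right\rbrace=\int_0^\infty p^{s-1}\;{}^{\Psi}F_{p}^{(\alpha,\beta)}(a,b;c;z)\,dp =\frac{{}^{\Psi}\Gamma^{(\alpha,\beta)}(s)\,B(b+s,c+s-b)}{B(b,c-b)}\;{}_{2}F_{1}(a,b+s;c+2s;z).$$
   Context: For $\alpha,\beta\in\mathbb{C}$ with $\mathrm{Re}(\alpha)>-1$, the Wright function is ${}_{0}\Psi_{1}(\alpha,\beta;z)=\sum_{n=0}^{\infty}\frac{1}{\Gamma(\alpha n+\beta)}\frac{z^n}{n!}$ (with $1/\Gamma$ equal to $0$ at the poles of $\Gamma$). For $\mathrm{Re}(x)>0$, $\mathrm{Re}(y)>0$, $\mathrm{Re}(p)>0$ the $\Psi$-beta function is $${}^{\Psi}B_{p}^{(\alpha,\beta)}(x,y)=\int_{0}^{1}t^{x-1}(1-t)^{y-1}\,{}_{0}\Psi_{1}\left(\alpha,\beta;-\frac{p}{t(1-t)}\right)dt.$$ The $\Psi$-gamma function is ${}^{\Psi}\Gamma_{p}^{(\alpha,\beta)}(x)=\int_{0}^{\infty}t^{x-1}\,{}_{0}\Psi_{1}\left(\alpha,\beta;-t-\frac{p}{t}\right)dt$,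 and ${}^{\Psi}\Gamma^{(\alpha,\beta)}(s)$ denotes its case $p=0$, i.e. ${}^{\Psi}\Gamma^{(\alpha,\beta)}(s)=\int_{0}^{\infty}v^{s-1}\,{}_{0}\Psi_{1}(\alpha,\beta;-v)\,dv$. The $\Psi$-Gauss hypergeometric function is $${}^{\Psi}F_{p}^{(\alpha,\beta)}(a,b;c;z)=\sum_{n=0}^{\infty}(a)_{n}\frac{{}^{\Psi}B_{p}^{(\alpha,\beta)}(b+n,c-b)}{B(b,c-b)}\frac{z^{n}}{n!},$$ and for $z$ with $|\arg(1-z)|<\pi$ outside the disc of convergence it is understood as the analytic continuation of this series in $z$. Here $B$ is the classical beta function, $(a)_n=a(a+1)\cdots(a+n-1)$ with $(a)_0=1$, and ${}_2F_1$ is the classical Gauss hypergeometric function (principal branch).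
   Formalization: It is additionally assumed that the integral defining ΨΓ^(α,β)(s), ∫_0^∞ v^(s-1) 0Ψ1(α,β;-v) dv, converges (possibly conditionally); otherwise the right side is undefined, e.g. for α=β=1 and Re(s) ≥ 3/4. *)

theory Defs
  imports "HOL-Complex_Analysis.Complex_Analysis"
begin

text \<open>
  All integrals are Henstock--Kurzweil integrals. For the integrands occurring here, which are
  continuous on an open interval, this is the improper Riemann integral (Hake's theorem), so
  conditionally convergent integrals are included.
\<close>

definition wright_psi :: "complex \<Rightarrow> complex \<Rightarrow> complex \<Rightarrow> complex" where
  "wright_psi \<alpha> \<beta> z = (\<Sum>n. rGamma (\<alpha> * of_nat n + \<beta>) * z ^ n / fact n)"

definition psi_beta :: "complex \<Rightarrow> complex \<Rightarrow> complex \<Rightarrow> complex \<Rightarrow> complex \<Rightarrow> complex" where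
  "psi_beta \<alpha> \<beta> p x y =
     integral {0<..<1} (\<lambda>t::real. of_real t powr (x - 1) * of_real (1 - t) powr (y - 1) *
       wright_psi \<alpha> \<beta> (- p / of_real (t * (1 - t))))"

definition psi_gamma :: "complex \<Rightarrow> complex \<Rightarrow> complex \<Rightarrow> complex \<Rightarrow> complex" where
  "psi_gamma \<alpha> \<beta> p x =
     integral {0<..} (\<lambda>t::real. of_real t powr (x - 1) *
       wright_psi \<alpha> \<beta> (- of_real t - p / of_real t))"

text \<open>
  The condition \<open>z \<noteq> 1\<close> is needed because the library sets \<open>Arg 0 = 0\<close>; the set is the complex
  plane without the real half-line from 1 to infinity.
\<close>
definition cut_plane :: "complex set" where
  "cut_plane = {z. z \<noteq> 1 \<and> \<bar>Arg (1 - z)\<bar> < pi}"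

text \<open>
  The analytic continuation to the cut plane of the sum of a power series with coefficients \<open>u\<close>
  that converges on the unit disc. The cut plane is connected and contains the unit disc, so the
  continuation is unique there if it exists; values outside the cut plane are meaningless.
\<close>
definition cut_continuation :: "(nat \<Rightarrow> complex) \<Rightarrow> complex \<Rightarrow> complex" where
  "cut_continuation u =
     (SOME F. F holomorphic_on cut_plane \<and> (\<forall>w\<in>ball 0 1. (\<lambda>n. u n * w ^ n) sums F w))"

definition gauss_hypergeo :: "complex \<Rightarrow> complex \<Rightarrow> complex \<Rightarrow> complex \<Rightarrow> complex" where
  "gauss_hypergeo a b c =
     cut_continuation (\<lambda>n. pochhammer a n * pochhammer b n / (pochhammer c n * fact n))"

definition psi_hypergeo ::
  "complex \<Rightarrow> complex \<Rightarrow> complex \<Rightarrow> complex \<Rightarrow> complex \<Rightarrow> complex \<Rightarrow> complex \<Rightarrow> complex" where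
  "psi_hypergeo \<alpha> \<beta> p a b c =
     cut_continuation
       (\<lambda>n. pochhammer a n * (psi_beta \<alpha> \<beta> p (b + of_nat n) (c - b) / Beta b (c - b)) / fact n)"

definition mellin :: "(real \<Rightarrow> complex) \<Rightarrow> complex \<Rightarrow> complex" where
  "mellin f s = integral {0<..} (\<lambda>p::real. of_real p powr (s - 1) * f p)"

end

theory Submission
  imports Defs
begin

text \<open>
  Write $h(v) = v^{s-1}\,\Psi(-v)$ for the Wright function $\Psi$ and $H(v) = \int_0^v h$. The
  integral of $h$ over the half-line may converge only conditionally, so neither Fubini's theorem
  nor dominated convergence applies to it. What convergence does give is that $H$ is bounded and
  tends to $0$ at $0$ and to $L = \int_0^\infty h$, the value of the Psi-gamma function, at
  infinity. The whole proof works with $H$ in place of $h$.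

  Put $u = t(1-t)$ and $\varphi(t) = t^{b+s-1}(1-t)^{c-b+s-1}(1-zt)^{-a}$, which is absolutely
  integrable on the unit interval. The integral $K(p) = \int_0^1 \varphi(t)\,H(p/u)\,dt$ converges
  absolutely, and dominated convergence gives $K(p) \to 0$ at $0$ and
  $K(p) \to L\int_0^1\varphi$ at infinity. Differentiation under the integral sign gives
  $K'(p) = p^{s-1}\int_0^1 t^{b-1}(1-t)^{c-b-1}(1-zt)^{-a}\,\Psi(-p/u)\,dt$, and this last integral
  is $B(b,c-b)$ times the Psi-hypergeometric function at $z$. The fundamental theorem of calculus
  on the half-line therefore evaluates the Mellin transform, because $\int_0^1\varphi$ is the Euler
  integral of ${}_2F_1(a,b+s;c+2s;z)$. This last part is \<open>has_integral_mellin_kernel\<close>.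

  The integral over $t$ converges only conditionally as well, and two facts about it are needed:
  that it continues the defining power series in $z$ to the cut plane, and that it is the locally
  uniform limit in $p$ of its truncations, which justifies the differentiation. Both come from one
  estimate. Up to a constant factor and a power of $p$, the factor $\Psi(-p/u)$ is
  $u^{s+1}/u'$ times the derivative of $H(p/u)$ with respect to $t$. Integrating by parts near
  $t = 0$ replaces the unbounded oscillating factor by the bounded $H$, at the price of one
  derivative of the remaining factor (\<open>psi_kernel_left_bound\<close>). So the integral of
  $t^{b-1}(1-t)^{c-b-1}\,\Psi(-p/u)\,g(t)$ depends on $g$ as a functional that is bounded in the
  $C^1$ norm, with a controlled tail at both ends; the locale \<open>C1_functional\<close> records this. For
  $g(t) = (1-wt)^{-a}$ the $C^1$ norm is locally bounded in $w$ on the cut plane, and on the unit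
  disc the binomial series converges in $C^1$. This yields holomorphy and the power series
  (\<open>cut_continuation_binomial_transform\<close>). The kernel of the beta integral is a functional of the
  same kind, which gives the Euler integral.

  Finally, $\Psi$ has to be continuous. This needs the convergence of its power series, hence a
  bound for $1/\Gamma(\alpha n+\beta)$ with complex $\alpha$ (\<open>norm_rGamma_le\<close>).
\<close>

section \<open>Growth of the reciprocal Gamma function and the Wright function\<close>

text \<open>
  The partial products increase to $\sinh(\pi Y)/(\pi Y)$, by the product formula for the sine at
  the imaginary point $iY$.
\<close>
lemma prod_one_plus_le_exp:
  fixes Y :: real
  assumes "Y \<ge> 1"
  shows "(\<Prod>k=1..m. 1 + Y\<^sup>2 / (real k)\<^sup>2) \<le> exp (pi * Y)"
proof -
  define P where "P m = (\<Prod>k=1..m. 1 + Y\<^sup>2 / (real k)\<^sup>2)" for m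
  have P1: "P m \<ge> 1" for m
    unfolding P_def by (rule prod_ge_1) auto
  have "incseq P"
  proof (rule incseq_SucI)
    fix n
    have "P n * 1 \<le> P n * (1 + Y\<^sup>2 / (real (Suc n))\<^sup>2)"
      using P1[of n] by (intro mult_left_mono) auto
    then show "P n \<le> P (Suc n)" by (simp add: P_def)
  qed
  have "norm (of_real pi * (\<i> * of_real Y) * (\<Prod>k=1..n. 1 - (\<i> * of_real Y)\<^sup>2 / (of_nat k)\<^sup>2)) = pi * Y * P n" for n
  proof -
    have "(\<Prod>k=1..n. 1 - (\<i> * complex_of_real Y)\<^sup>2 / (of_nat k)\<^sup>2) = of_real (P n)"
      unfolding P_def of_real_prod by (intro prod.cong) (auto simp: power_mult_distrib)
    then show ?thesis using assms P1[of n] by (simp add: norm_mult)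
  qed
  with tendsto_norm[OF sin_product_formula_complex[of "\<i> * of_real Y"]]
  have lim: "(\<lambda>n. pi * Y * P n) \<longlonglongrightarrow> norm (sin (of_real pi * (\<i> * complex_of_real Y)))" by simp
  have "norm (sin (of_real pi * (\<i> * complex_of_real Y))) \<le> exp (pi * Y)"
  proof -
    have "norm (sin (of_real pi * (\<i> * complex_of_real Y))) \<le> 
        (norm (exp (\<i> * (of_real pi * (\<i> * complex_of_real Y)))) + norm (exp (- (\<i> * (of_real pi * (\<i> * complex_of_real Y)))))) / 2"
      unfolding sin_exp_eq using norm_triangle_ineq4[of "exp (\<i> * (of_real pi * (\<i> * complex_of_real Y)))" "exp (- (\<i> * (of_real pi * (\<i> * complex_of_real Y))))"]
      by (simp only: norm_divide norm_mult norm_ii norm_numeral) simp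
    also have "\<dots> = (exp (-(pi*Y)) + exp (pi * Y)) / 2"
      by (simp add: norm_exp_eq_Re)
    also have "\<dots> \<le> exp (pi * Y)" using assms by simp
    finally show ?thesis .
  qed
  moreover have "pi * Y * P m \<le> norm (sin (of_real pi * (\<i> * complex_of_real Y)))"
    by (rule incseq_le[OF _ lim]) (use \<open>incseq P\<close> assms in \<open>auto simp: incseq_def intro!: mult_left_mono\<close>)
  moreover have "P m \<le> pi * Y * P m"
  proof -
    have "1 \<le> pi * Y" using mult_mono[of 1 pi 1 Y] assms pi_gt3 by simp
    then show ?thesis using P1[of m] by (simp add: mult_le_cancel_right1)
  qed
  ultimately show ?thesis unfolding P_def by linarith
qed

text \<open>
  In the Euler limit for $1/\Gamma(x+iy)$ every factor $|x+k+iy|$ exceeds $x+k$ by at most the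
  factor $1+y^2/(k+1)^2$ when $x \ge 1$, and the product of these factors is bounded by the sine
  product. Enlarging $|y|$ to $|y|+1$ meets the requirement $Y \ge 1$ of that bound.
\<close>
lemma norm_rGamma_le_exp_Im:
  assumes "1 \<le> Re z"
  shows "norm (rGamma z) \<le> rGamma (Re z) * exp (pi * (\<bar>Im z\<bar> + 1))"
proof (rule LIMSEQ_le)
  define Y where "Y = \<bar>Im z\<bar> + 1"
  show "(\<lambda>n. norm (rGamma_series z n)) \<longlonglongrightarrow> norm (rGamma z)"
    by (intro tendsto_intros)
  show "(\<lambda>n. rGamma_series (Re z) n * exp (pi * (\<bar>Im z\<bar> + 1))) \<longlonglongrightarrow> rGamma (Re z) * exp (pi * (\<bar>Im z\<bar> + 1))"
    by (intro tendsto_intros)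
  have "norm (rGamma_series z n) \<le> rGamma_series (Re z) n * exp (pi * (\<bar>Im z\<bar> + 1))" for n
  proof -
    have factor: "norm (z + of_nat k) \<le> (Re z + real k) * (1 + Y\<^sup>2 / (real (Suc k))\<^sup>2)" for k
    proof -
      let ?r = "Re z + real k"
      have r: "real (Suc k) \<le> ?r" "0 < ?r" using assms by auto
      have "(norm (z + of_nat k))\<^sup>2 = ?r\<^sup>2 + (Im z)\<^sup>2" by (simp add: cmod_power2)
      also have "\<dots> \<le> ?r\<^sup>2 + Y\<^sup>2" 
        using abs_le_square_iff[of "Im z" Y] by (simp add: Y_def)
      also have "\<dots> = ?r\<^sup>2 * (1 + Y\<^sup>2 / ?r\<^sup>2)" using r by (simp add: field_simps)
      also have "\<dots> \<le> ?r\<^sup>2 * (1 + Y\<^sup>2 / (real (Suc k))\<^sup>2)" 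
        using r by (intro mult_left_mono add_left_mono divide_left_mono power_mono mult_pos_pos zero_less_power) auto
      also have "\<dots> \<le> ?r\<^sup>2 * (1 + Y\<^sup>2 / (real (Suc k))\<^sup>2)\<^sup>2" 
        by (intro mult_left_mono) (auto simp: power2_eq_square intro!: mult_le_cancel_left1[THEN iffD2])
      also have "\<dots> = (?r * (1 + Y\<^sup>2 / (real (Suc k))\<^sup>2))\<^sup>2" by (simp add: power_mult_distrib)
      finally show ?thesis
        by (rule power2_le_imp_le) (use r in \<open>auto intro!: mult_nonneg_nonneg add_nonneg_nonneg\<close>)
    qed
    have "norm (pochhammer z (n+1)) = (\<Prod>k<n+1. norm (z + of_nat k))"
      by (simp add: pochhammer_prod prod_norm atLeast0LessThan)
    also have "\<dots> \<le> (\<Prod>k<n+1. (Re z + real k) * (1 + Y\<^sup>2 / (real (Suc k))\<^sup>2))"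
      by (intro prod_mono) (use factor in auto)
    also have "\<dots> = pochhammer (Re z) (n+1) * (\<Prod>k<n+1. (1 + Y\<^sup>2 / (real (Suc k))\<^sup>2))"
      by (simp add: pochhammer_prod prod.distrib atLeast0LessThan)
    also have "(\<Prod>k<n+1. (1 + Y\<^sup>2 / (real (Suc k))\<^sup>2)) = (\<Prod>k=1..n+1. 1 + Y\<^sup>2 / (real k)\<^sup>2)"
      by (rule prod.reindex_bij_witness[of _ "\<lambda>k. k - 1" Suc]) auto
    also have "pochhammer (Re z) (n+1) * \<dots> \<le> pochhammer (Re z) (n+1) * exp (pi * Y)"
      by (intro mult_left_mono prod_one_plus_le_exp pochhammer_nonneg) (use assms in \<open>auto simp: Y_def\<close>)
    finally have *: "norm (pochhammer z (n+1)) \<le> pochhammer (Re z) (n+1) * exp (pi * Y)" .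
    have "norm (rGamma_series z n) = norm (pochhammer z (n+1)) / (fact n * exp (Re z * ln (real n)))"
      by (simp add: rGamma_series_def norm_divide norm_mult norm_exp_eq_Re del: pochhammer_Suc)
    also have "\<dots> \<le> (pochhammer (Re z) (n+1) * exp (pi * Y)) / (fact n * exp (Re z * ln (real n)))"
      by (intro divide_right_mono *) auto
    also have "\<dots> = rGamma_series (Re z) n * exp (pi * (\<bar>Im z\<bar> + 1))"
      by (simp add: rGamma_series_def Y_def)
    finally show ?thesis .
  qed
  then show "\<exists>N. \<forall>n\<ge>N. norm (rGamma_series z n) \<le> rGamma_series (Re z) n * exp (pi * (\<bar>Im z\<bar> + 1))"
    by blast
qed

lemma norm_rGamma_le_exp_Im_strip:
  obtains C where "C > 0" "\<And>z. 1 \<le> Re z \<Longrightarrow> Re z \<le> 2 \<Longrightarrow> norm (rGamma z) \<le> C * exp (pi * \<bar>Im z\<bar>)"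
proof -
  have "continuous_on {1..2::real} rGamma" by (rule continuous_on_rGamma)
  then have "bounded (rGamma ` {1..2::real})"
    using compact_Icc compact_continuous_image compact_imp_bounded by blast
  then obtain B where "B > 0" "\<forall>y\<in>rGamma ` {1..2::real}. norm y \<le> B"
    unfolding bounded_pos by blast
  then have B: "B > 0" "\<And>x. x \<in> {1..2::real} \<Longrightarrow> norm (rGamma x) \<le> B" by auto
  show ?thesis
  proof (rule that[of "B * exp pi"])
    fix z :: complex assume z: "1 \<le> Re z" "Re z \<le> 2"
    have "norm (rGamma z) \<le> rGamma (Re z) * exp (pi * (\<bar>Im z\<bar> + 1))"
      by (rule norm_rGamma_le_exp_Im[OF z(1)])
    also have "\<dots> \<le> B * exp (pi * (\<bar>Im z\<bar> + 1))"
      using B(2)[of "Re z"] z by (intro mult_right_mono) auto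
    finally show "norm (rGamma z) \<le> B * exp pi * exp (pi * \<bar>Im z\<bar>)"
      by (simp add: exp_add algebra_simps)
  qed (use B in auto)
qed

text \<open>
  Shifting $z$ by an integer into the strip $1 \le \mathrm{Re} \le 2$ costs a Pochhammer factor.
  For $\mathrm{Re}\,z \ge 1$ this factor only helps. For $\mathrm{Re}\,z < 1$ it has about
  $-\mathrm{Re}\,z$ terms, each of size at most $|z|+\kappa+1$; the number $\kappa$ is an upper
  bound for the number of terms.
\<close>
lemma norm_rGamma_le:
  obtains C where "C > 0"
    "\<And>z \<kappa>. 0 \<le> \<kappa> \<Longrightarrow> 2 - Re z \<le> \<kappa> \<Longrightarrow>
       norm (rGamma z) \<le> C * exp (pi * \<bar>Im z\<bar>) * (norm z + \<kappa> + 1) powr \<kappa>"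
proof -
  obtain C where C: "C > 0" "\<And>z. 1 \<le> Re z \<Longrightarrow> Re z \<le> 2 \<Longrightarrow> norm (rGamma z) \<le> C * exp (pi * \<bar>Im z\<bar>)"
    using norm_rGamma_le_exp_Im_strip by blast
  show ?thesis
  proof (rule that[OF C(1)])
    fix z :: complex and \<kappa> :: real assume \<kappa>: "0 \<le> \<kappa>" "2 - Re z \<le> \<kappa>"
    have ge1: "1 \<le> (norm z + \<kappa> + 1) powr \<kappa>" using \<kappa> by (intro ge_one_powr_ge_zero) auto
    show "norm (rGamma z) \<le> C * exp (pi * \<bar>Im z\<bar>) * (norm z + \<kappa> + 1) powr \<kappa>"
    proof (cases "Re z \<ge> 1")
      case True
      define m where "m = nat (\<lfloor>Re z\<rfloor> - 1)"
      have m: "real m \<le> Re z - 1" "Re z - 2 \<le> real m" using True unfolding m_def by linarith+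
      define w where "w = z - of_nat m"
      have w: "1 \<le> Re w" "Re w \<le> 2" "Im w = Im z" using m by (auto simp: w_def)
      have "1 \<le> norm (w + of_nat k)" for k
        by (rule order_trans[OF _ complex_Re_le_cmod]) (use w in auto)
      then have "1 \<le> norm (pochhammer w m)"
        by (simp add: pochhammer_prod prod_norm[symmetric] prod_ge_1)
      moreover have "rGamma w = pochhammer w m * rGamma z"
        using pochhammer_rGamma[of w m] by (simp add: w_def)
      ultimately have "norm (rGamma z) \<le> norm (rGamma w)"
        by (simp add: norm_mult mult_le_cancel_right1)
      also have "\<dots> \<le> C * exp (pi * \<bar>Im z\<bar>)" using C(2)[of w] w by simp
      also have "\<dots> \<le> C * exp (pi * \<bar>Im z\<bar>) * (norm z + \<kappa> + 1) powr \<kappa>"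
        using mult_left_mono[OF ge1, of "C * exp (pi * \<bar>Im z\<bar>)"] C(1) by simp
      finally show ?thesis .
    next
      case False
      define m where "m = nat \<lceil>1 - Re z\<rceil>"
      have m: "1 \<le> Re z + real m" "Re z + real m \<le> 2" "real m \<le> \<kappa>" using False \<kappa> unfolding m_def by linarith+
      have fac: "norm (z + of_nat k) \<le> norm z + \<kappa> + 1" if "k < m" for k
        using norm_triangle_ineq[of z "of_nat k"] that m by simp
      have "norm (pochhammer z m) \<le> (\<Prod>k<m. norm z + \<kappa> + 1)"
        unfolding pochhammer_prod prod_norm[symmetric] atLeast0LessThan
        by (intro prod_mono) (use fac in auto)
      also have "\<dots> = (norm z + \<kappa> + 1) powr m" using \<kappa>
        by (subst powr_realpow) (auto simp: add_nonneg_pos)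
      also have "\<dots> \<le> (norm z + \<kappa> + 1) powr \<kappa>" using m \<kappa> by (intro powr_mono) auto
      finally have p: "norm (pochhammer z m) \<le> (norm z + \<kappa> + 1) powr \<kappa>" .
      have "norm (rGamma z) = norm (pochhammer z m) * norm (rGamma (z + of_nat m))"
        by (subst pochhammer_rGamma[of z m]) (simp add: norm_mult)
      also have "\<dots> \<le> (norm z + \<kappa> + 1) powr \<kappa> * (C * exp (pi * \<bar>Im z\<bar>))"
        using C(2)[of "z + of_nat m"] m by (intro mult_mono p) auto
      finally show ?thesis by (simp add: mult_ac)
    qed
  qed
qed

lemma fact_ge_power_div_exp: "(real n / exp 1) ^ n \<le> fact n"
proof -
  have "real n ^ n / fact n \<le> exp (real n)"
  proof -
    have "(\<Sum>k\<in>{n}. inverse (fact k) *\<^sub>R real n ^ k) \<le> (\<Sum>k. inverse (fact k) *\<^sub>R real n ^ k)"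
      by (rule sum_le_suminf[OF summable_exp_generic]) auto
    then show ?thesis by (simp add: exp_def field_simps)
  qed
  then show ?thesis by (simp add: power_divide field_simps flip: exp_of_nat_mult)
qed

text \<open>
  Along $z = \alpha n+\beta$ the bound for $1/\Gamma$ grows like $n^{\rho n}$ with
  $\rho = \max(0,-\mathrm{Re}\,\alpha) < 1$, up to exponential factors, so it is beaten by $n!$.
\<close>
lemma wright_psi_summable:
  assumes "Re \<alpha> > -1"
  shows "summable (\<lambda>n. rGamma (\<alpha> * of_nat n + \<beta>) / fact n * z ^ n)"
proof -
  obtain C where C: "C > 0" "\<And>z \<kappa>. 0 \<le> \<kappa> \<Longrightarrow> 2 - Re z \<le> \<kappa> \<Longrightarrow>
       norm (rGamma z) \<le> C * exp (pi * \<bar>Im z\<bar>) * (norm z + \<kappa> + 1) powr \<kappa>"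
    using norm_rGamma_le by blast
  \<comment> \<open>The number \<open>\<rho> * n + k0\<close> plays the role of \<open>\<kappa>\<close> in the bound for the reciprocal Gamma function.\<close>
  define \<rho> where "\<rho> = max 0 (- Re \<alpha>)"
  define k0 where "k0 = max 0 (2 - Re \<beta>)"
  have \<rho>: "0 \<le> \<rho>" "\<rho> < 1" "- Re \<alpha> \<le> \<rho>" using assms by (auto simp: \<rho>_def)
  have k0: "0 \<le> k0" "2 - Re \<beta> \<le> k0" by (auto simp: k0_def)
  define D where "D = norm \<alpha> + \<rho> + norm \<beta> + k0 + 1"
  have D: "D > 0" using \<rho> k0 by (auto simp: D_def add_nonneg_pos)
  have lnD: "ln (2 * D) \<ge> 0" using \<rho> k0 by (auto simp: D_def)
  define R where "R = norm z + 1"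
  have R: "R > 0" by (auto simp: R_def add_nonneg_pos)
  define c where "c = pi * (\<bar>Im \<alpha>\<bar> + \<bar>Im \<beta>\<bar>)"
  \<comment> \<open>\<open>K\<close> collects the logarithms of all the factors that grow only exponentially in \<open>n\<close>.\<close>
  define K where "K = c + (\<rho> + k0) * ln (2 * D) + k0 + ln R + 1"
  have le: "norm (rGamma (\<alpha> * of_nat n + \<beta>) / fact n * z ^ n) \<le> C * exp (real n * (K - (1 - \<rho>) * ln (real n)))"
    if n: "n > 0" for n
  proof -
    let ?w = "\<alpha> * of_nat n + \<beta>" and ?k = "\<rho> * real n + k0" and ?l = "ln (real n)"
    have k: "0 \<le> ?k" using \<rho> k0 by auto
    have "Re \<alpha> * real n \<ge> - (\<rho> * real n)" 
      using \<rho>(3) by (metis minus_le_iff mult_minus_left mult_right_mono of_nat_0_le_iff)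
    then have k2: "2 - Re ?w \<le> ?k" using k0 by simp
    have "1 \<le> real n" using n by simp
    note scale = mult_left_mono[OF this, simplified]
    have "norm ?w \<le> norm \<alpha> * real n + norm \<beta>"
      using norm_triangle_ineq[of "\<alpha> * of_nat n" \<beta>] by (simp add: norm_mult)
    then have "norm ?w + ?k + 1 \<le> D * real n"
      unfolding D_def using scale[of "norm \<beta>"] scale[of k0] n k0 by (simp add: algebra_simps)
    then have "norm ?w + ?k + 1 \<le> 2 * D * real n" using mult_nonneg_nonneg[of D "real n"] D unfolding mult.assoc by linarith
    then have "(norm ?w + ?k + 1) powr ?k \<le> (2 * D * real n) powr ?k"
      using k by (intro powr_mono2) (auto simp: add_nonneg_nonneg)
    also have "\<dots> = exp (?k * (ln (2 * D) + ?l))" using n D by (simp add: powr_def ln_mult)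
    finally have 1: "(norm ?w + ?k + 1) powr ?k \<le> exp (?k * (ln (2 * D) + ?l))" .
    have "\<bar>Im ?w\<bar> \<le> (\<bar>Im \<alpha>\<bar> + \<bar>Im \<beta>\<bar>) * real n"
      using abs_triangle_ineq[of "Im \<alpha> * real n" "Im \<beta>"] scale[of "\<bar>Im \<beta>\<bar>"]
      by (simp add: abs_mult algebra_simps)
    then have 2: "exp (pi * \<bar>Im ?w\<bar>) \<le> exp (c * real n)"
      by (simp add: c_def mult.assoc)
    have "norm (rGamma ?w) \<le> C * exp (pi * \<bar>Im ?w\<bar>) * (norm ?w + ?k + 1) powr ?k"
      by (rule C(2)[OF k k2])
    also have "\<dots> \<le> C * exp (c * real n) * exp (?k * (ln (2 * D) + ?l))"
      using C(1) by (intro mult_mono 1 2) auto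
    finally have 3: "norm (rGamma ?w) \<le> C * exp (c * real n) * exp (?k * (ln (2 * D) + ?l))" .
    have "exp (real n * (?l - 1)) \<le> fact n"
    proof -
      have "exp (real n * (?l - 1)) = (real n / exp 1) ^ n"
        using n by (simp add: exp_of_nat_mult exp_diff)
      then show ?thesis using fact_ge_power_div_exp[of n] by simp
    qed
    then have 4: "inverse (fact n) \<le> exp (- (real n * (?l - 1)))"
      unfolding exp_minus by (intro le_imp_inverse_le) auto
    have 5: "norm z ^ n \<le> exp (real n * ln R)"
    proof -
      have "exp (real n * ln R) = R ^ n" using R by (simp add: exp_of_nat_mult)
      then show ?thesis by (auto simp: R_def intro!: power_mono)
    qed
    have 6: "c * real n + ?k * (ln (2 * D) + ?l) + real n * ln R - real n * (?l - 1) \<le> real n * (K - (1 - \<rho>) * ?l)"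
    proof -
      have "?l \<le> real n" using ln_le_minus_one[of "real n"] n by simp
      then have "k0 * ?l \<le> k0 * real n" using k0 by (intro mult_left_mono) auto
      moreover have "k0 * ln (2 * D) \<le> k0 * ln (2 * D) * real n"
        using scale[of "k0 * ln (2 * D)"] k0 lnD by simp
      ultimately show ?thesis by (simp add: K_def algebra_simps)
    qed
    have "norm (rGamma ?w / fact n * z ^ n) = norm (rGamma ?w) * norm z ^ n * inverse (fact n)"
      by (simp add: norm_mult norm_divide norm_power) (simp add: divide_inverse)
    also have "\<dots> \<le> C * exp (c * real n) * exp (?k * (ln (2 * D) + ?l)) * exp (real n * ln R) * exp (- (real n * (?l - 1)))"
      using C(1) by (intro mult_mono 3 4 5 order.refl) auto
    also have "\<dots> = C * exp (c * real n + ?k * (ln (2 * D) + ?l) + real n * ln R - real n * (?l - 1))"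
      by (simp add: exp_add exp_minus exp_diff divide_inverse mult_ac)
    also have "\<dots> \<le> C * exp (real n * (K - (1 - \<rho>) * ?l))"
      using C(1) 6 by simp
    finally show ?thesis .
  qed
  have "eventually (\<lambda>n. ln (real n) \<ge> (K + ln 2) / (1 - \<rho>)) sequentially"
    by (rule filterlim_compose[OF ln_at_top filterlim_real_sequentially, unfolded filterlim_at_top, rule_format])
  then have "eventually (\<lambda>n. norm (rGamma (\<alpha> * of_nat n + \<beta>) / fact n * z ^ n) \<le> C * (1/2) ^ n) sequentially"
    using eventually_gt_at_top[of "0::nat"]
  proof eventually_elim
    case (elim n)
    have "K - (1 - \<rho>) * ln (real n) \<le> - ln 2" using elim(1) \<rho>(2) by (simp add: field_simps)
    then have "real n * (K - (1 - \<rho>) * ln (real n)) \<le> real n * (- ln 2)" by (intro mult_left_mono) auto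
    then have "exp (real n * (K - (1 - \<rho>) * ln (real n))) \<le> exp (real n * (- ln 2))" by simp
    also have "\<dots> = (1/2) ^ n" by (simp add: exp_of_nat_mult exp_minus inverse_eq_divide power_one_over)
    finally show ?case using order_trans[OF le[OF elim(2)] mult_left_mono[of _ _ C]] C(1) by simp
  qed
  then show ?thesis
    by (rule summable_comparison_test_ev) (auto intro: summable_geometric)
qed

lemma continuous_on_wright_psi:
  assumes "Re \<alpha> > -1"
  shows "continuous_on UNIV (wright_psi \<alpha> \<beta>)"
proof -
  have eq: "wright_psi \<alpha> \<beta> = (\<lambda>z. \<Sum>n. rGamma (\<alpha> * of_nat n + \<beta>) / fact n * z ^ n)"
    by (simp add: wright_psi_def fun_eq_iff)
  have "isCont (\<lambda>z. \<Sum>n. rGamma (\<alpha> * of_nat n + \<beta>) / fact n * z ^ n) z" for z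
    by (rule isCont_powser[OF wright_psi_summable[OF assms, of \<beta> "of_real (norm z + 1)"]])
       (simp del: of_real_add)
  then show ?thesis unfolding eq by (simp add: continuous_at_imp_continuous_on)
qed

section \<open>Improper Henstock--Kurzweil integrals on the half-line\<close>

text \<open>
  A function with an antiderivative that is continuous at $0$ and has a limit at infinity is
  integrable in the sense of Henstock and Kurzweil without being absolutely integrable.
\<close>
lemma has_integral_Ioi_FTC:
  fixes K f :: "real \<Rightarrow> complex"
  assumes cont: "continuous_on {0..} K"
    and deriv: "\<And>x. x > 0 \<Longrightarrow> (K has_vector_derivative f x) (at x)"
    and lim: "(K \<longlongrightarrow> L) at_top"
  shows "(f has_integral (L - K 0)) {0<..}"
proof -
  have fin: "(f has_integral (K y - K 0)) {0..y}" if "y \<ge> 0" for y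
    by (rule fundamental_theorem_of_calculus_interior)
       (use that deriv in \<open>auto intro: continuous_on_subset[OF cont]\<close>)
  have restrict: "((\<lambda>x. if x \<in> {0<..} then f x else 0) has_integral I) (cbox a b) \<longleftrightarrow> (f has_integral I) {max a 0..b}" for a b I
  proof -
    have "((\<lambda>x. if x \<in> {0<..} then f x else 0) has_integral I) (cbox a b) \<longleftrightarrow> (f has_integral I) ({0<..} \<inter> cbox a b)"
      by (rule has_integral_restrict_Int)
    also have "\<dots> \<longleftrightarrow> (f has_integral I) {max a 0..b}"
      by (rule has_integral_spike_set_eq) (rule negligible_subset[of "{0}"], auto)+
    finally show ?thesis .
  qed
  show ?thesis unfolding has_integral_alt'[of f]
  proof (intro conjI allI impI)
    fix a b :: real
    have "f integrable_on {0..\<bar>b\<bar>}" using fin[of "\<bar>b\<bar>"] by auto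
    then have "f integrable_on {max a 0..b}"
      by (rule integrable_on_subinterval) auto
    then show "(\<lambda>x. if x \<in> {0<..} then f x else 0) integrable_on cbox a b"
      unfolding integrable_on_def restrict .
  next
    fix e :: real assume "e > 0"
    then obtain N where N: "\<And>y. y \<ge> N \<Longrightarrow> dist (K y) L < e"
      using tendstoD[OF lim] unfolding eventually_at_top_linorder by blast
    show "\<exists>B>0. \<forall>a b. ball 0 B \<subseteq> cbox a b \<longrightarrow>
        norm (integral (cbox a b) (\<lambda>x. if x \<in> {0<..} then f x else 0) - (L - K 0)) < e"
    proof (intro exI[of _ "\<bar>N\<bar> + 1"] conjI allI impI)
      fix a b :: real assume sub: "ball 0 (\<bar>N\<bar> + 1) \<subseteq> cbox a b"
      have "0 \<in> ball 0 (\<bar>N\<bar> + 1)" "\<bar>N\<bar> \<in> ball 0 (\<bar>N\<bar> + 1)" by auto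
      then have "0 \<in> cbox a b" "\<bar>N\<bar> \<in> cbox a b" using sub by blast+
      then have b: "a \<le> 0" "\<bar>N\<bar> \<le> b" by auto
      then have "((\<lambda>x. if x \<in> {0<..} then f x else 0) has_integral (K b - K 0)) (cbox a b)"
        unfolding restrict using fin[of b] by (simp add: max_def)
      then have "integral (cbox a b) (\<lambda>x. if x \<in> {0<..} then f x else 0) = K b - K 0"
        by (rule integral_unique)
      then show "norm (integral (cbox a b) (\<lambda>x. if x \<in> {0<..} then f x else 0) - (L - K 0)) < e"
        using N[of b] b by (simp add: dist_norm)
    qed simp
  qed
qed

lemma has_integral_to_inf_D:
  fixes f :: "real \<Rightarrow> complex"
  assumes "(f has_integral G) {0<..}"
  shows "f integrable_on {0..v}" and "((\<lambda>v. integral {0..v} f) \<longlongrightarrow> G) at_top"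
proof -
  let ?g = "\<lambda>x. if x \<in> {0<..} then f x else 0"
  have int: "?g integrable_on cbox a b" for a b
    using assms unfolding has_integral_alt'[of f] by blast
  have "negligible {0::real}" by simp
  then have sp: "integral {0..v} ?g = integral {0..v} f" for v
    by (rule integral_spike) auto
  show "f integrable_on {0..v}" for v
    by (rule integrable_spike[OF int[of 0 v, simplified] \<open>negligible {0}\<close>]) auto
  have ext: "integral {-w..v} ?g = integral {0..v} f" if "v \<ge> 0" "w \<ge> 0" for v w
  proof -
    have "integral {-w..0} ?g = 0" by (subst integral_cong[where g = "\<lambda>_. 0"]) auto
    then have "integral {-w..v} ?g = integral {0..v} ?g"
      using Henstock_Kurzweil_Integration.integral_combine[OF _ _ int[of "-w" v, simplified], of 0] that by simp
    then show ?thesis using sp by simp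
  qed
  show "((\<lambda>v. integral {0..v} f) \<longlongrightarrow> G) at_top"
  proof (rule tendstoI)
    fix e :: real assume "e > 0"
    then obtain B where B: "B > 0" "\<And>a b. ball 0 B \<subseteq> cbox a b \<Longrightarrow> norm (integral (cbox a b) ?g - G) < e"
      using assms unfolding has_integral_alt'[of f] by blast
    show "\<forall>\<^sub>F v in at_top. dist (integral {0..v} f) G < e"
      using eventually_ge_at_top[of B]
    proof eventually_elim
      case (elim v)
      have "ball 0 B \<subseteq> cbox (-B) v" using elim by (auto simp: dist_real_def)
      from B(2)[OF this] show ?case using ext[of v B] elim B(1) by (simp add: dist_norm)
    qed
  qed
qed

text \<open>
  All the information on a conditionally convergent integral that the main argument uses.
\<close>
lemma bounded_primitive_of_improper_integrable:
  fixes h :: "real \<Rightarrow> complex"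
  assumes int: "(h has_integral G) {0<..}" and cont: "continuous_on {0<..} h"
  defines "H \<equiv> \<lambda>v. integral {0..v} h"
  obtains M where "M > 0" "\<And>v. v > 0 \<Longrightarrow> norm (H v) \<le> M"
    "\<And>v. v > 0 \<Longrightarrow> (H has_vector_derivative h v) (at v)"
    "(H \<longlongrightarrow> 0) (at_right 0)" "(H \<longlongrightarrow> G) at_top"
proof -
  have lim: "(H \<longlongrightarrow> G) at_top" unfolding H_def by (rule has_integral_to_inf_D(2)[OF int])
  have ii: "h integrable_on {0..v}" for v by (rule has_integral_to_inf_D(1)[OF int])
  have contH: "continuous_on {0..v} H" for v unfolding H_def by (rule indefinite_integral_continuous_1[OF ii])
  have deriv: "(H has_vector_derivative h v) (at v)" if "v > 0" for v
  proof -
    have "(H has_vector_derivative h v) (at v within {0..v+1})"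
      unfolding H_def
      using integral_has_vector_derivative_continuous_at[OF ii, of v "v + 1" "{}"] that
        continuous_on_eq_continuous_at[OF open_greaterThan, of 0 h] cont
      by (auto intro: continuous_at_imp_continuous_at_within)
    then show ?thesis using that by (simp add: at_within_Icc_at)
  qed
  have "((\<lambda>v. H v) \<longlongrightarrow> H 0) (at 0 within {0..1})"
    using contH[of 1] by (auto simp: continuous_on_def)
  then have lim0: "(H \<longlongrightarrow> 0) (at_right 0)"
    by (simp add: H_def at_within_Icc_at_right)
  have "\<forall>\<^sub>F v in at_top. norm (H v) < norm G + 1"
    using tendsto_norm[OF lim] by (rule order_tendstoD) simp
  then obtain N where N: "\<And>v. v \<ge> N \<Longrightarrow> norm (H v) < norm G + 1"
    unfolding eventually_at_top_linorder by blast
  have "bounded (H ` {0..\<bar>N\<bar>})"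
    by (intro compact_imp_bounded compact_continuous_image contH) auto
  then obtain M where M: "M > 0" "\<forall>y\<in>H ` {0..\<bar>N\<bar>}. norm y \<le> M" unfolding bounded_pos by blast
  show ?thesis
  proof (rule that[of "M + norm G + 1"])
    fix v :: real assume "v > 0"
    then show "norm (H v) \<le> M + norm G + 1"
    proof (cases "v \<le> \<bar>N\<bar>")
      case True
      then have "norm (H v) \<le> M" using M(2) \<open>v > 0\<close> by auto
      then show ?thesis using norm_ge_zero[of G] by linarith
    next
      case False
      then show ?thesis using N[of v] M(1) by linarith
    qed
  qed (use M deriv lim lim0 in \<open>auto simp: add_pos_nonneg\<close>)
qed

section \<open>Improper integrals on the unit interval\<close>

text \<open>
  Any null sequence in $(0,1/4]$ would serve; the bound $1/4$ keeps the truncation points in the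
  region where the estimates at the two ends of the unit interval hold.
\<close>
definition cutoff :: "nat \<Rightarrow> real" where
  "cutoff n = inverse (real (n + 4))"

lemma cutoff_bounds: "0 < cutoff n" "cutoff n \<le> 1/4"
  by (auto simp: cutoff_def field_simps)

lemma cutoff_tendsto: "cutoff \<longlonglongrightarrow> 0"
  using LIMSEQ_ignore_initial_segment[OF LIMSEQ_inverse_real_of_nat, of 3]
  by (simp add: cutoff_def[abs_def] add.commute)

lemma cutoff_at_right_0: "filterlim cutoff (at_right 0) sequentially"
  unfolding filterlim_at using cutoff_tendsto cutoff_bounds(1)
  by (auto simp: less_imp_neq[THEN not_sym] intro!: always_eventually)

lemma has_integral_reflect_unit:
  fixes f :: "real \<Rightarrow> complex"
  assumes "(f has_integral I) {a..b}"
  shows "((\<lambda>t. f (1 - t)) has_integral I) {1 - b..1 - a}"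
proof -
  have "(\<lambda>x. 1 - x) ` {a..b} = {1 - b..1 - a}"
    by (auto simp: image_iff intro: bexI[of _ "1 - _"])
  then show ?thesis
    using has_integral_affinity[of f I a b "-1" 1] assms by simp
qed

lemma integral_reflect_unit:
  fixes f :: "real \<Rightarrow> complex"
  shows "integral {1 - b..1 - a} (\<lambda>t. f (1 - t)) = integral {a..b} f"
proof (cases "f integrable_on {a..b}")
  case True
  then show ?thesis using has_integral_reflect_unit by (blast intro: integral_unique)
next
  case False
  moreover have "\<not> (\<lambda>t. f (1 - t)) integrable_on {1 - b..1 - a}"
    using has_integral_reflect_unit[of "\<lambda>t. f (1 - t)" _ "1 - b" "1 - a"] False
    by (auto simp: integrable_on_def)
  ultimately show ?thesis by (simp add: not_integrable_integral)
qed

text \<open>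
  Hake's theorem at the left end: by the tail bound the integrals over $[x,1/2]$ satisfy the Cauchy
  criterion as $x \to 0$, and their limit completes them to a continuous antiderivative on the
  closed interval.
\<close>
lemma improper_integral_left_end:
  fixes f :: "real \<Rightarrow> complex"
  assumes cont: "continuous_on {0<..<1} f" and lim: "(\<sigma> \<longlongrightarrow> 0) (at_right 0)"
    and tail: "\<And>d e. 0 < d \<Longrightarrow> d \<le> e \<Longrightarrow> e \<le> 1/4 \<Longrightarrow> norm (integral {d..e} f) \<le> \<sigma> e"
  shows "f integrable_on {0..1/2}"
    and "\<And>e. 0 < e \<Longrightarrow> e \<le> 1/4 \<Longrightarrow> norm (integral {0..1/2} f - integral {e..1/2} f) \<le> \<sigma> e"
proof -
  define J where "J x = integral {x..1/2} f" for x
  have int: "f integrable_on {x..y}" if "0 < x" "y < 1" for x y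
    using that by (intro integrable_continuous_real continuous_on_subset[OF cont]) auto
  have J_diff: "J d - J e = integral {d..e} f" if "0 < d" "d \<le> e" "e \<le> 1/2" for d e
    using Henstock_Kurzweil_Integration.integral_combine[OF that(2,3) int] that
    by (simp add: J_def algebra_simps)
  have J_tail: "norm (J d - J e) \<le> \<sigma> e" if "0 < d" "d \<le> e" "e \<le> 1/4" for d e
    using tail[OF that] that by (simp add: J_diff)
  have "Cauchy (\<lambda>n. J (cutoff n))"
  proof (rule metric_CauchyI)
    fix e :: real assume "e > 0"
    then have "\<forall>\<^sub>F n in sequentially. \<sigma> (cutoff n) < e"
      using filterlim_compose[OF lim cutoff_at_right_0] by (intro order_tendstoD)
    then obtain N where N: "\<And>n. n \<ge> N \<Longrightarrow> \<sigma> (cutoff n) < e" unfolding eventually_sequentially by blast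
    have le: "dist (J (cutoff m)) (J (cutoff n)) < e" if "m \<ge> n" "n \<ge> N" for m n
    proof -
      have "cutoff m \<le> cutoff n" using that by (simp add: cutoff_def)
      then have "norm (J (cutoff m) - J (cutoff n)) \<le> \<sigma> (cutoff n)"
        by (intro J_tail cutoff_bounds)
      then show ?thesis using N[of n] that by (simp add: dist_norm)
    qed
    show "\<exists>M. \<forall>m\<ge>M. \<forall>n\<ge>M. dist (J (cutoff m)) (J (cutoff n)) < e"
    proof (intro exI[of _ N] allI impI)
      fix m n assume "N \<le> m" "N \<le> n"
      then show "dist (J (cutoff m)) (J (cutoff n)) < e"
        using le[of m n] le[of n m] by (cases "m \<le> n") (auto simp: dist_commute)
    qed
  qed
  then obtain l where l: "(\<lambda>n. J (cutoff n)) \<longlonglongrightarrow> l"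
    using Cauchy_convergent convergent_def by blast
  have l_tail: "norm (l - J e) \<le> \<sigma> e" if "0 < e" "e \<le> 1/4" for e
  proof (rule LIMSEQ_le_const2)
    show "(\<lambda>n. norm (J (cutoff n) - J e)) \<longlonglongrightarrow> norm (l - J e)" by (intro tendsto_intros l)
    have "\<forall>\<^sub>F n in sequentially. cutoff n < e" using cutoff_tendsto that by (intro order_tendstoD)
    then show "\<exists>N. \<forall>n\<ge>N. norm (J (cutoff n) - J e) \<le> \<sigma> e"
      unfolding eventually_sequentially using J_tail[OF cutoff_bounds(1) less_imp_le that(2)] by blast
  qed
  have J_lim: "(J \<longlongrightarrow> l) (at_right 0)"
  proof (rule Lim_null[THEN iffD2], rule Lim_null_comparison[OF _ lim])
    show "\<forall>\<^sub>F e in at_right 0. norm (J e - l) \<le> \<sigma> e"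
    proof (rule eventually_mono)
      show "\<forall>\<^sub>F e in at_right (0::real). e \<in> {0<..<1/4}" by (rule eventually_at_right_real) simp
    qed (use l_tail in \<open>auto simp: norm_minus_commute\<close>)
  qed
  have J_deriv: "(J has_vector_derivative - f t) (at t)" if "t \<in> {0<..<1/2}" for t
  proof -
    have eq: "J u = J (t/2) - integral {t/2..u} f" if "u \<in> {t/2..1/2}" for u
      using J_diff[of "t/2" u] that \<open>t \<in> {0<..<1/2}\<close> by (simp add: algebra_simps)
    have "((\<lambda>u. integral {t/2..u} f) has_vector_derivative f t) (at t within {t/2..1/2})"
      using that by (intro integral_has_vector_derivative continuous_on_subset[OF cont]) auto
    then have "((\<lambda>u. J (t/2) - integral {t/2..u} f) has_vector_derivative 0 - f t) (at t within {t/2..1/2})"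
      by (intro derivative_intros)
    then have "(J has_vector_derivative 0 - f t) (at t within {t/2..1/2})"
      by (rule has_vector_derivative_transform[rotated 2, where f = "\<lambda>u. J (t/2) - integral {t/2..u} f"])
         (use that in simp, rule eq)
    then show ?thesis using that by (simp add: at_within_Icc_at)
  qed
  define F where "F t = (if t = 0 then l else J t)" for t
  have "continuous_on {0..1/2} F"
    unfolding continuous_on_eq_continuous_within
  proof
    fix t :: real assume t: "t \<in> {0..1/2}"
    show "continuous (at t within {0..1/2}) F"
    proof (cases "t = 0")
      case True
      have "(F \<longlongrightarrow> l) (at_right 0)"
        by (rule Lim_transform_eventually[OF J_lim]) (auto simp: F_def eventually_at_filter)
      then show ?thesis using True by (simp add: continuous_within at_within_Icc_at_right F_def)
    next
      case False
      then have "continuous_on {t/2..1/2} J"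
        unfolding J_def by (intro indefinite_integral_continuous_1' int) (use t in auto)
      then have "continuous (at t within {t/2..1/2}) J"
        using t False by (auto simp: continuous_on_eq_continuous_within)
      moreover have "at t within {t/2..1/2} = at t within {0..1/2}"
        by (rule at_within_nhd[of _ "{t/2<..}"]) (use t False in auto)
      ultimately have "(J \<longlongrightarrow> J t) (at t within {0..1/2})" by (simp add: continuous_within)
      then have "(F \<longlongrightarrow> J t) (at t within {0..1/2})"
        by (rule Lim_transform_eventually)
           (rule eventually_mono[OF eventually_neq_at_within[of 0]], simp add: F_def)
      then show ?thesis using False by (simp add: continuous_within F_def)
    qed
  qed
  moreover have "(F has_vector_derivative - f t) (at t)" if "t \<in> {0<..<1/2}" for t
    by (rule has_vector_derivative_transform_within_open[OF J_deriv[OF that], of "{0<..}"])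
       (use that in \<open>auto simp: F_def\<close>)
  ultimately have "((\<lambda>t. - f t) has_integral (F (1/2) - F 0)) {0..1/2}"
    by (intro fundamental_theorem_of_calculus_interior) auto
  then have "((\<lambda>t. - (- f t)) has_integral - (F (1/2) - F 0)) {0..1/2}"
    by (rule has_integral_neg)
  then have has: "(f has_integral l) {0..1/2}"
    by (simp add: F_def J_def)
  then show "f integrable_on {0..1/2}" by blast
  show "norm (integral {0..1/2} f - integral {e..1/2} f) \<le> \<sigma> e" if "0 < e" "e \<le> 1/4" for e
    using l_tail[OF that] has by (simp add: integral_unique J_def)
qed

lemma improper_integral_unit_interval:
  fixes f :: "real \<Rightarrow> complex"
  assumes cont: "continuous_on {0<..<1} f" and lim: "(\<sigma> \<longlongrightarrow> 0) (at_right 0)"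
    and left: "\<And>d e. 0 < d \<Longrightarrow> d \<le> e \<Longrightarrow> e \<le> 1/4 \<Longrightarrow> norm (integral {d..e} f) \<le> \<sigma> e"
    and right: "\<And>d e. 0 < d \<Longrightarrow> d \<le> e \<Longrightarrow> e \<le> 1/4 \<Longrightarrow> norm (integral {1 - e..1 - d} f) \<le> \<sigma> e"
  shows "f integrable_on {0<..<1}"
    and "\<And>e. 0 < e \<Longrightarrow> e \<le> 1/4 \<Longrightarrow> norm (integral {0<..<1} f - integral {e..1 - e} f) \<le> 2 * \<sigma> e"
proof -
  note L = improper_integral_left_end[OF cont lim left]
  have cont': "continuous_on {0<..<1} (\<lambda>t. f (1 - t))"
    by (rule continuous_on_compose2[OF cont]) (auto intro!: continuous_intros)
  have R: "(\<lambda>t. f (1 - t)) integrable_on {0..1/2}"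
    "\<And>e. 0 < e \<Longrightarrow> e \<le> 1/4 \<Longrightarrow> norm (integral {0..1/2} (\<lambda>t. f (1 - t)) - integral {e..1/2} (\<lambda>t. f (1 - t))) \<le> \<sigma> e"
    by (rule improper_integral_left_end[OF cont' lim], use right integral_reflect_unit[of "1 - _" "1 - _" f] in simp)+
  have R1: "f integrable_on {1/2..1}"
    using has_integral_reflect_unit[of "\<lambda>t. f (1 - t)" _ 0 "1/2"] R(1) by (auto simp: integrable_on_def)
  have int: "f integrable_on {0..1}"
    by (rule Henstock_Kurzweil_Integration.integrable_combine[OF _ _ L(1) R1]) auto
  then show "f integrable_on {0<..<1}" by (simp add: integrable_on_open_interval_real)
  fix e :: real assume e: "0 < e" "e \<le> 1/4"
  have int_e: "f integrable_on {e..1 - e}" by (rule integrable_on_subinterval[OF int]) (use e in auto)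
  have "integral {0<..<1} f = integral {0..1/2} f + integral {1/2..1} f"
    using Henstock_Kurzweil_Integration.integral_combine[OF _ _ int, of "1/2"] by (simp add: integral_open_interval_real)
  moreover have "integral {e..1 - e} f = integral {e..1/2} f + integral {1/2..1 - e} f"
    using Henstock_Kurzweil_Integration.integral_combine[OF _ _ int_e, of "1/2"] e by simp
  moreover have "integral {1/2..1} f = integral {0..1/2} (\<lambda>t. f (1 - t))" "integral {1/2..1 - e} f = integral {e..1/2} (\<lambda>t. f (1 - t))"
    using integral_reflect_unit[of 1 "1/2" f] integral_reflect_unit[of "1 - e" "1/2" f] by simp_all
  ultimately have "integral {0<..<1} f - integral {e..1 - e} f =
     (integral {0..1/2} f - integral {e..1/2} f) + (integral {0..1/2} (\<lambda>t. f (1 - t)) - integral {e..1/2} (\<lambda>t. f (1 - t)))"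
    by simp
  also have "norm \<dots> \<le> \<sigma> e + \<sigma> e" by (intro norm_triangle_mono L(2) R(2) e)
  finally show "norm (integral {0<..<1} f - integral {e..1 - e} f) \<le> 2 * \<sigma> e" by simp
qed

lemma truncated_integral_tendsto:
  fixes f :: "real \<Rightarrow> 'a::euclidean_space"
  assumes "f integrable_on {0<..<1}"
  shows "((\<lambda>e. integral {e..1 - e} f) \<longlongrightarrow> integral {0<..<1} f) (at_right 0)"
proof -
  have int: "f integrable_on {0..1}" using assms by (simp add: integrable_on_open_interval_real)
  define J where "J x = integral {0..x} f" for x
  have cJ: "continuous_on {0..1} J" unfolding J_def by (rule indefinite_integral_continuous_1[OF int])
  have "continuous_on {0..1} (\<lambda>e. J (1 - e) - J e)"
    by (intro continuous_on_diff cJ continuous_on_compose2[OF cJ]) (auto intro!: continuous_intros)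
  then have "((\<lambda>e. J (1 - e) - J e) \<longlongrightarrow> J (1 - 0) - J 0) (at 0 within {0..1})"
    unfolding continuous_on_def by (rule bspec) simp
  then have "((\<lambda>e. J (1 - e) - J e) \<longlongrightarrow> integral {0<..<1} f) (at_right 0)"
    by (simp add: at_within_Icc_at_right J_def integral_open_interval_real)
  then show ?thesis
  proof (rule Lim_transform_eventually)
    have "\<forall>\<^sub>F e in at_right (0::real). e \<in> {0<..<1/2}" by (rule eventually_at_right_real) simp
    then show "\<forall>\<^sub>F e in at_right 0. J (1 - e) - J e = integral {e..1 - e} f"
    proof (rule eventually_mono)
      fix e :: real assume e: "e \<in> {0<..<1/2}"
      have "f integrable_on {0..1 - e}" by (rule integrable_on_subinterval[OF int]) (use e in auto)
      then have "J e + integral {e..1 - e} f = J (1 - e)"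
        unfolding J_def by (intro Henstock_Kurzweil_Integration.integral_combine) (use e in auto)
      then show "J (1 - e) - J e = integral {e..1 - e} f" by (simp add: algebra_simps)
    qed
  qed
qed

text \<open>
  The integrals over compact subintervals are holomorphic by differentiation under the integral,
  and the tail bound makes their convergence locally uniform.
\<close>
lemma holomorphic_improper_integral:
  fixes f f' :: "complex \<Rightarrow> real \<Rightarrow> complex"
  assumes S: "open S"
    and deriv: "\<And>w t. w \<in> S \<Longrightarrow> t \<in> {0<..<1} \<Longrightarrow> ((\<lambda>w. f w t) has_field_derivative f' w t) (at w)"
    and cont: "continuous_on (S \<times> {0<..<1}) (\<lambda>(w, t). f w t)"
    and cont': "continuous_on (S \<times> {0<..<1}) (\<lambda>(w, t). f' w t)"
    and tail: "\<And>z. z \<in> S \<Longrightarrow> \<exists>r>0. cball z r \<subseteq> S \<and> (\<exists>\<tau>. (\<tau> \<longlongrightarrow> 0) (at_right 0) \<and>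
      (\<forall>w\<in>cball z r. \<forall>e\<in>{0<..1/4}. norm (integral {0<..<1} (f w) - integral {e..1 - e} (f w)) \<le> \<tau> e))"
  shows "(\<lambda>w. integral {0<..<1} (f w)) holomorphic_on S"
proof -
  have "(\<lambda>w. integral {0<..<1} (f w)) field_differentiable at z" if z: "z \<in> S" for z
  proof -
    obtain r \<tau> where r: "r > 0" "cball z r \<subseteq> S" "(\<tau> \<longlongrightarrow> 0) (at_right 0)"
      and \<tau>: "\<And>w e. w \<in> cball z r \<Longrightarrow> e \<in> {0<..1/4} \<Longrightarrow> norm (integral {0<..<1} (f w) - integral {e..1 - e} (f w)) \<le> \<tau> e"
      using tail[OF z] by blast
    have sub: "ball z r \<times> {cutoff n..1 - cutoff n} \<subseteq> S \<times> {0<..<1}" for n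
      using r(2) cutoff_bounds[of n] ball_subset_cball[of z r] by (intro Sigma_mono) auto
    have "(\<lambda>w. integral {0<..<1} (f w)) holomorphic_on ball z r"
    proof (rule holomorphic_uniform_sequence)
      fix n
      have cont_t: "continuous_on {cutoff n..1 - cutoff n} (f w)" if "w \<in> ball z r" for w
      proof -
        have "continuous_on {cutoff n..1 - cutoff n} (\<lambda>t. (\<lambda>(w, t). f w t) (w, t))"
          by (rule continuous_on_compose2[OF continuous_on_subset[OF cont sub[of n]]])
             (use that in \<open>auto intro!: continuous_intros\<close>)
        then show ?thesis by simp
      qed
      show "(\<lambda>w. integral {cutoff n..1 - cutoff n} (f w)) holomorphic_on ball z r"
        unfolding cbox_interval[symmetric]
      proof (rule leibniz_rule_holomorphic[where fx = f'], unfold cbox_interval)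
        fix w t assume "w \<in> ball z r" "t \<in> {cutoff n..1 - cutoff n}"
        then show "((\<lambda>w. f w t) has_field_derivative f' w t) (at w within ball z r)"
          using subsetD[OF sub[of n], of "(w, t)"] by (auto intro!: has_field_derivative_at_within[OF deriv])
      next
        fix w assume "w \<in> ball z r"
        then show "f w integrable_on {cutoff n..1 - cutoff n}"
          using cont_t by (intro integrable_continuous_real) auto
      next
        show "continuous_on (ball z r \<times> {cutoff n..1 - cutoff n}) (\<lambda>(w, t). f' w t)"
          by (rule continuous_on_subset[OF cont' sub])
      qed auto
    next
      fix y assume "y \<in> ball z r"
      then obtain d where d: "d > 0" "cball y d \<subseteq> ball z r"
        using open_ball open_contains_cball by metis
      have "uniform_limit (cball y d) (\<lambda>n w. integral {cutoff n..1 - cutoff n} (f w)) (\<lambda>w. integral {0<..<1} (f w)) sequentially"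
      proof (rule uniform_limitI)
        fix e :: real assume "e > 0"
        then have "\<forall>\<^sub>F n in sequentially. \<tau> (cutoff n) < e"
          using filterlim_compose[OF r(3) cutoff_at_right_0] by (intro order_tendstoD)
        then show "\<forall>\<^sub>F n in sequentially. \<forall>w\<in>cball y d. dist (integral {cutoff n..1 - cutoff n} (f w)) (integral {0<..<1} (f w)) < e"
        proof eventually_elim
          case (elim n)
          show ?case
          proof
            fix w assume "w \<in> cball y d"
            then have "w \<in> cball z r" using d ball_subset_cball[of z r] by blast
            then show "dist (integral {cutoff n..1 - cutoff n} (f w)) (integral {0<..<1} (f w)) < e"
              using \<tau>[of w "cutoff n"] cutoff_bounds[of n] elim by (simp add: dist_norm norm_minus_commute)
          qed
        qed
      qed
      then show "\<exists>d>0. cball y d \<subseteq> ball z r \<and>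
          uniform_limit (cball y d) (\<lambda>n w. integral {cutoff n..1 - cutoff n} (f w)) (\<lambda>w. integral {0<..<1} (f w)) sequentially"
        using d by blast
    qed auto
    then show ?thesis
      using r(1) by (simp add: holomorphic_on_imp_differentiable_at)
  qed
  then show ?thesis
    unfolding holomorphic_on_def by (blast intro: field_differentiable_at_within)
qed

section \<open>Analytic continuation to the cut plane\<close>

lemma cut_plane_altdef: "cut_plane = {w. 1 - w \<notin> \<real>\<^sub>\<le>\<^sub>0}"
proof -
  have "(z \<noteq> 0 \<and> \<bar>Arg z\<bar> < pi) \<longleftrightarrow> z \<notin> \<real>\<^sub>\<le>\<^sub>0" for z
    using Arg_eq_pi[of z] Arg_le_pi[of z] mpi_less_Arg[of z] Arg_zero
    by (auto simp: complex_nonpos_Reals_iff complex_eq_iff abs_if)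
  from this[of "1 - _"] show ?thesis by (auto simp: cut_plane_def)
qed

lemma open_cut_plane: "open cut_plane"
proof -
  have "open ((\<lambda>w. 1 - w) -` (- \<real>\<^sub>\<le>\<^sub>0 :: complex set))"
    by (intro open_vimage open_Compl closed_nonpos_Reals_complex continuous_intros)
  then show ?thesis by (simp add: cut_plane_altdef vimage_def)
qed

text \<open>
  The cut plane is star-shaped about $0$, so the principal branch of $(1-wt)^{-a}$ is analytic in
  $w$ on the cut plane for every $t$ in the unit interval.
\<close>
lemma cut_plane_scale:
  assumes "w \<in> cut_plane" "0 \<le> t" "t \<le> (1::real)"
  shows "1 - w * of_real t \<notin> \<real>\<^sub>\<le>\<^sub>0" 
proof
  assume *: "1 - w * of_real t \<in> \<real>\<^sub>\<le>\<^sub>0"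
  then have "t \<noteq> 0" by auto
  with assms have t: "t > 0" by simp
  from * have "Im w = 0" "1 \<le> Re w * t" using t by (auto simp: complex_nonpos_Reals_iff)
  moreover have "0 < Re w"
    using calculation t zero_less_mult_iff[of "Re w" t] by simp
  then have "Re w * t \<le> Re w" using assms by (simp add: mult_left_le)
  ultimately have "1 - w \<in> \<real>\<^sub>\<le>\<^sub>0" by (auto simp: complex_nonpos_Reals_iff)
  with assms show False by (simp add: cut_plane_altdef)
qed

lemma connected_cut_plane: "connected cut_plane"
proof -
  have "starlike cut_plane" unfolding starlike_def
  proof (intro bexI[of _ 0] ballI subsetI)
    fix w x assume w: "w \<in> cut_plane" and "x \<in> closed_segment 0 w"
    then obtain u where "0 \<le> u" "u \<le> 1" "x = u *\<^sub>R w" by (auto simp: closed_segment_def)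
    then show "x \<in> cut_plane" using cut_plane_scale[OF w, of u] by (simp add: cut_plane_altdef scaleR_conv_of_real mult.commute)
  qed (simp add: cut_plane_altdef complex_nonpos_Reals_iff)
  then show ?thesis by (rule starlike_imp_connected)
qed

lemma ball_subset_cut_plane: "ball 0 1 \<subseteq> cut_plane"
proof
  fix w :: complex assume "w \<in> ball 0 1"
  then have "Re w < 1" using complex_Re_le_cmod[of w] by simp
  then show "w \<in> cut_plane" by (simp add: cut_plane_altdef complex_nonpos_Reals_iff)
qed

text \<open>
  The continuation is defined by a choice, so it can be computed by exhibiting one continuation:
  this shows that the choice has a witness, and the identity theorem shows that it is unique.
\<close>
lemma cut_continuation_eqI:
  assumes F: "F holomorphic_on cut_plane" "\<And>w. w \<in> ball 0 1 \<Longrightarrow> (\<lambda>n. u n * w ^ n) sums F w"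
    and z: "z \<in> cut_plane"
  shows "cut_continuation u z = F z"
proof -
  let ?G = "cut_continuation u"
  have "?G holomorphic_on cut_plane \<and> (\<forall>w\<in>ball 0 1. (\<lambda>n. u n * w ^ n) sums ?G w)"
    unfolding cut_continuation_def by (rule someI[where x = F]) (use F in blast)
  then have G: "?G holomorphic_on cut_plane" "\<And>w. w \<in> ball 0 1 \<Longrightarrow> (\<lambda>n. u n * w ^ n) sums ?G w" by auto
  show ?thesis
  proof (rule analytic_continuation_open[of "ball 0 1" cut_plane ?G F])
    show "?G w = F w" if "w \<in> ball 0 1" for w
      using F(2) G(2) sums_unique2 that by blast
  qed (use F G z open_cut_plane connected_cut_plane ball_subset_cut_plane in auto)
qed

section \<open>Functionals that are bounded in the C1 norm\<close>

definition C1_bound :: "(real \<Rightarrow> complex) \<Rightarrow> real \<Rightarrow> bool" where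
  "C1_bound g A \<longleftrightarrow> (\<exists>g'. continuous_on {0<..<1} g' \<and>
     (\<forall>t\<in>{0<..<1}. (g has_vector_derivative g' t) (at t) \<and> norm (g t) \<le> A \<and> norm (g' t) \<le> A))"

lemma C1_bound_continuous_on: "C1_bound g A \<Longrightarrow> continuous_on {0<..<1} g"
  unfolding C1_bound_def
  by (metis continuous_at_imp_continuous_on has_vector_derivative_continuous)

lemma C1_bound_nonneg: "C1_bound g A \<Longrightarrow> 0 \<le> A"
proof -
  assume "C1_bound g A"
  then have "norm (g (1/2)) \<le> A" unfolding C1_bound_def by auto
  then show "0 \<le> A" by (rule order_trans[OF norm_ge_zero])
qed

lemma C1_bound_reflect:
  assumes "C1_bound g A"
  shows "C1_bound (\<lambda>t. g (1 - t)) A"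
proof -
  obtain g' where g': "continuous_on {0<..<1} g'"
    "\<And>t. t \<in> {0<..<1} \<Longrightarrow> (g has_vector_derivative g' t) (at t)"
    "\<And>t. t \<in> {0<..<1} \<Longrightarrow> norm (g t) \<le> A" "\<And>t. t \<in> {0<..<1} \<Longrightarrow> norm (g' t) \<le> A"
    using assms unfolding C1_bound_def by blast
  have "((\<lambda>t. g (1 - t)) has_vector_derivative - g' (1 - t)) (at t)" if "t \<in> {0<..<1}" for t
  proof -
    have "((g \<circ> (\<lambda>t. 1 - t)) has_vector_derivative (-1) *\<^sub>R g' (1 - t)) (at t)"
      by (rule vector_diff_chain_at) (use that g'(2) in \<open>auto intro!: derivative_eq_intros\<close>)
    then show ?thesis by (simp add: o_def)
  qed
  moreover have "continuous_on {0<..<1} (\<lambda>t. - g' (1 - t))"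
    by (intro continuous_intros continuous_on_compose2[OF g'(1)]) auto
  ultimately show ?thesis
    unfolding C1_bound_def using g'(3,4) by (intro exI[of _ "\<lambda>t. - g' (1 - t)"]) auto
qed

lemma C1_bound_power: "C1_bound (\<lambda>t. of_real t ^ n) (real n + 1)"
  unfolding C1_bound_def
proof (intro exI[of _ "\<lambda>t. of_nat n * of_real t ^ (n - 1)"] conjI ballI)
  fix t :: real assume t: "t \<in> {0<..<1}"
  show "((\<lambda>t. complex_of_real t ^ n) has_vector_derivative of_nat n * of_real t ^ (n - 1)) (at t)"
    by (rule has_vector_derivative_real_field) (auto intro!: derivative_eq_intros)
  have le1: "t ^ k \<le> 1" for k using t by (intro power_le_one) auto
  show "norm (complex_of_real t ^ n) \<le> real n + 1"
    using le1[of n] t by (simp add: norm_power add_increasing)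
  have "real n * t ^ (n - 1) \<le> real n" by (rule mult_left_le[OF le1]) simp
  then show "norm (of_nat n * complex_of_real t ^ (n - 1)) \<le> real n + 1"
    using t by (simp add: norm_mult norm_power)
qed (auto intro!: continuous_intros)

text \<open>
  Joint continuity of the binomial kernel gives, by compactness, bounds for its $C^1$ norm that are
  locally uniform in $w$.
\<close>
lemma continuous_on_binomial_kernel:
  "continuous_on (cut_plane \<times> {0..1}) (\<lambda>(w, t). (1 - w * of_real t) powr s)"
proof -
  have "continuous_on (cut_plane \<times> {0..1}) (\<lambda>x. exp (s * Ln (1 - fst x * of_real (snd x))))"
    by (intro continuous_intros) (use cut_plane_scale in auto)
  moreover have "1 - w * of_real t \<noteq> 0" if "w \<in> cut_plane" "t \<in> {0..1}" for w t
    using cut_plane_scale[OF that(1), of t] that by auto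
  ultimately show ?thesis
    by (elim continuous_on_eq) (auto simp: powr_def)
qed

lemma has_vector_derivative_binomial_kernel:
  assumes "w \<in> cut_plane" "t \<in> {0..1}"
  shows "((\<lambda>t. (1 - w * of_real t) powr s) has_vector_derivative - w * s * (1 - w * of_real t) powr (s - 1)) (at t)"
  by (rule has_vector_derivative_real_field)
     (use cut_plane_scale[OF assms(1), of t] assms in \<open>auto intro!: derivative_eq_intros\<close>)

lemma C1_bound_binomial_kernel:
  assumes W: "compact W" "W \<subseteq> cut_plane"
  obtains A where "\<And>w. w \<in> W \<Longrightarrow> C1_bound (\<lambda>t. (1 - w * of_real t) powr s) A"
proof -
  have cont: "continuous_on (W \<times> {0..1}) (\<lambda>x. (1 - fst x * of_real (snd x)) powr s)" for s
    using continuous_on_subset[OF continuous_on_binomial_kernel, of "W \<times> {0..1}"] W by (auto simp: case_prod_unfold)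
  have cpt: "compact (W \<times> {0..1::real})" using W by (intro compact_Times) auto
  have bdd: "\<exists>B. \<forall>w\<in>W. \<forall>t\<in>{0..1}. norm (f (w, t)) \<le> B" if "continuous_on (W \<times> {0..1}) f" for f :: "complex \<times> real \<Rightarrow> complex"
    using compact_imp_bounded[OF compact_continuous_image[OF that cpt]] by (auto simp: bounded_iff)
  have "\<exists>B. \<forall>w\<in>W. \<forall>t\<in>{0..1}. norm ((\<lambda>x. (1 - fst x * of_real (snd x)) powr s) (w, t)) \<le> B"
    by (intro bdd cont)
  then obtain A1 where A1: "\<forall>w\<in>W. \<forall>t\<in>{0..1}. norm ((1 - w * of_real t) powr s) \<le> A1"
    by auto
  have "\<exists>B. \<forall>w\<in>W. \<forall>t\<in>{0..1}. norm ((\<lambda>x. - fst x * s * (1 - fst x * of_real (snd x)) powr (s - 1)) (w, t)) \<le> B"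
    by (intro bdd continuous_intros cont)
  then obtain A2 where A2: "\<forall>w\<in>W. \<forall>t\<in>{0..1}. norm (- w * s * (1 - w * of_real t) powr (s - 1)) \<le> A2"
    by auto
  show ?thesis
  proof (rule that[of "max A1 A2"])
    fix w assume w: "w \<in> W"
    show "C1_bound (\<lambda>t. (1 - w * of_real t) powr s) (max A1 A2)"
      unfolding C1_bound_def
    proof (intro exI[of _ "\<lambda>t. - w * s * (1 - w * of_real t) powr (s - 1)"] conjI ballI)
      show "continuous_on {0<..<1} (\<lambda>t. - w * s * (1 - w * of_real t) powr (s - 1))"
        by (intro continuous_intros continuous_on_compose2[OF cont, of _ "\<lambda>t. (w, t)", simplified]) (use w in auto)
      fix t :: real assume t: "t \<in> {0<..<1}"
      then have t': "t \<in> {0..1}" by auto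
      show "((\<lambda>t. (1 - w * of_real t) powr s) has_vector_derivative - w * s * (1 - w * of_real t) powr (s - 1)) (at t)"
        using has_vector_derivative_binomial_kernel w W t' by blast
      show "norm ((1 - w * of_real t) powr s) \<le> max A1 A2"
        using A1[rule_format, OF w t'] by (rule max.coboundedI1)
      show "norm (- w * s * (1 - w * of_real t) powr (s - 1)) \<le> max A1 A2"
        using A2[rule_format, OF w t'] by (rule max.coboundedI2)
    qed
  qed
qed

text \<open>
  The kernel \<open>q\<close> need not be absolutely integrable at $0$ and $1$. The two tail bounds say that
  its pairing with $g$ near either end is controlled by the $C^1$ norm of $g$, with a rate \<open>\<tau>\<close>
  that is the same for all $g$.
\<close>
locale C1_functional =
  fixes q :: "real \<Rightarrow> complex" and \<tau> :: "real \<Rightarrow> real"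
  assumes cont_q: "continuous_on {0<..<1} q"
    and lim_\<tau>: "(\<tau> \<longlongrightarrow> 0) (at_right 0)"
    and left: "C1_bound g A \<Longrightarrow> 0 < d \<Longrightarrow> d \<le> e \<Longrightarrow> e \<le> 1/4 \<Longrightarrow> norm (integral {d..e} (\<lambda>t. q t * g t)) \<le> A * \<tau> e"
    and right: "C1_bound g A \<Longrightarrow> 0 < d \<Longrightarrow> d \<le> e \<Longrightarrow> e \<le> 1/4 \<Longrightarrow> norm (integral {1 - e..1 - d} (\<lambda>t. q t * g t)) \<le> A * \<tau> e"
begin

lemma truncation:
  assumes "C1_bound g A"
  shows "(\<lambda>t. q t * g t) integrable_on {0<..<1}"
    and "\<And>e. 0 < e \<Longrightarrow> e \<le> 1/4 \<Longrightarrow> 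
      norm (integral {0<..<1} (\<lambda>t. q t * g t) - integral {e..1 - e} (\<lambda>t. q t * g t)) \<le> 2 * (A * \<tau> e)"
proof -
  have c: "continuous_on {0<..<1} (\<lambda>t. q t * g t)"
    by (intro continuous_intros cont_q C1_bound_continuous_on[OF assms])
  have l: "((\<lambda>e. A * \<tau> e) \<longlongrightarrow> 0) (at_right 0)"
    using tendsto_mult[OF tendsto_const[of A] lim_\<tau>] by simp
  note * = improper_integral_unit_interval[OF c l left[OF assms] right[OF assms]]
  show "(\<lambda>t. q t * g t) integrable_on {0<..<1}" by (rule *(1))
  show "norm (integral {0<..<1} (\<lambda>t. q t * g t) - integral {e..1 - e} (\<lambda>t. q t * g t)) \<le> 2 * (A * \<tau> e)"
    if "0 < e" "e \<le> 1/4" for e by (rule *(2)) (use that in auto)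
qed

lemma bounded:
  obtains N where "\<And>g A. C1_bound g A \<Longrightarrow> norm (integral {0<..<1} (\<lambda>t. q t * g t)) \<le> A * N"
proof -
  have cont: "continuous_on {1/4..3/4} q" by (rule continuous_on_subset[OF cont_q]) auto
  then have "bounded (q ` {1/4..3/4})" by (intro compact_imp_bounded compact_continuous_image) auto
  then obtain Q where Q: "\<And>t. t \<in> {1/4..3/4} \<Longrightarrow> norm (q t) \<le> Q" unfolding bounded_iff by blast
  show ?thesis
  proof (rule that[of "2 * \<tau> (1/4) + Q"])
    fix g A assume g: "C1_bound g A"
    have A: "A \<ge> 0" by (rule C1_bound_nonneg[OF g])
    have Q0: "Q \<ge> 0" using Q[of "1/2"] norm_ge_zero[of "q (1/2)"] by (simp del: norm_ge_zero)
    have "norm (q t * g t) \<le> Q * A" if "t \<in> {1/4..3/4}" for t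
      using g Q[OF that] that A Q0 unfolding C1_bound_def norm_mult by (intro mult_mono) auto
    then have "norm (integral {1/4..3/4} (\<lambda>t. q t * g t)) \<le> Q * A * (3/4 - 1/4)"
      by (intro integral_bound continuous_intros cont continuous_on_subset[OF C1_bound_continuous_on[OF g]]) auto
    also have "\<dots> \<le> Q * A" using mult_nonneg_nonneg[OF Q0 A] by (simp add: mult.commute)
    finally have 1: "norm (integral {1/4..3/4} (\<lambda>t. q t * g t)) \<le> Q * A" .
    have 2: "norm (integral {0<..<1} (\<lambda>t. q t * g t) - integral {1/4..3/4} (\<lambda>t. q t * g t)) \<le> 2 * (A * \<tau> (1/4))"
      using truncation(2)[OF g, of "1/4"] by simp
    have "norm (integral {0<..<1} (\<lambda>t. q t * g t)) \<le> 2 * (A * \<tau> (1/4)) + Q * A"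
      using norm_triangle_mono[OF 2 1] by simp
    then show "norm (integral {0<..<1} (\<lambda>t. q t * g t)) \<le> A * (2 * \<tau> (1/4) + Q)"
      by (simp add: algebra_simps)
  qed
qed

lemma holomorphic_binomial_transform:
  "(\<lambda>w. integral {0<..<1} (\<lambda>t. q t * (1 - w * of_real t) powr s)) holomorphic_on cut_plane"
proof (rule holomorphic_improper_integral[OF open_cut_plane])
  fix w :: complex and t :: real assume wt: "w \<in> cut_plane" "t \<in> {0<..<1}"
  then show "((\<lambda>w. q t * (1 - w * of_real t) powr s) has_field_derivative
      q t * (- of_real t * s * (1 - w * of_real t) powr (s - 1))) (at w)"
    using cut_plane_scale[OF wt(1), of t] by (auto intro!: derivative_eq_intros)
next
  have sub: "cut_plane \<times> {0<..<1::real} \<subseteq> cut_plane \<times> {0..1}" by auto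
  have q: "continuous_on (cut_plane \<times> {0<..<1}) (\<lambda>x. q (snd x))"
    by (rule continuous_on_compose2[OF cont_q]) (auto intro!: continuous_intros)
  note b = continuous_on_subset[OF continuous_on_binomial_kernel sub, unfolded case_prod_unfold]
  show "continuous_on (cut_plane \<times> {0<..<1}) (\<lambda>(w, t). q t * (1 - w * of_real t) powr s)"
    "continuous_on (cut_plane \<times> {0<..<1}) (\<lambda>(w, t). q t * (- of_real t * s * (1 - w * of_real t) powr (s - 1)))"
    unfolding case_prod_unfold by (intro continuous_intros q b)+
next
  fix z assume "z \<in> cut_plane"
  then obtain r where r: "r > 0" "cball z r \<subseteq> cut_plane"
    using open_contains_cball open_cut_plane by blast
  obtain A where A: "\<And>w. w \<in> cball z r \<Longrightarrow> C1_bound (\<lambda>t. (1 - w * of_real t) powr s) A"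
    using C1_bound_binomial_kernel[OF compact_cball r(2)] by blast
  have "((\<lambda>e. 2 * (A * \<tau> e)) \<longlongrightarrow> 2 * (A * 0)) (at_right 0)" by (intro tendsto_intros lim_\<tau>)
  then show "\<exists>r>0. cball z r \<subseteq> cut_plane \<and> (\<exists>\<tau>. (\<tau> \<longlongrightarrow> 0) (at_right 0) \<and>
      (\<forall>w\<in>cball z r. \<forall>e\<in>{0<..1/4}. norm (integral {0<..<1} (\<lambda>t. q t * (1 - w * of_real t) powr s) - 
         integral {e..1 - e} (\<lambda>t. q t * (1 - w * of_real t) powr s)) \<le> \<tau> e))"
  proof (intro exI[of _ r] conjI exI[of _ "\<lambda>e. 2 * (A * \<tau> e)"] ballI)
    fix w e assume "w \<in> cball z r" and e: "e \<in> {0<..1/4::real}"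
    show "norm (integral {0<..<1} (\<lambda>t. q t * (1 - w * of_real t) powr s) - 
         integral {e..1 - e} (\<lambda>t. q t * (1 - w * of_real t) powr s)) \<le> 2 * (A * \<tau> e)"
      by (rule truncation(2)[OF A[OF \<open>w \<in> cball z r\<close>]]) (use e in auto)
  qed (use r in auto)
qed

end

lemma sums_binomial_series:
  fixes x a :: complex
  assumes "norm x < 1"
  shows "(\<lambda>n. pochhammer a n / fact n * x ^ n) sums (1 - x) powr (- a)"
proof -
  have "(\<lambda>n. ((- a) gchoose n) * (- x) ^ n) sums (1 + (- x)) powr (- a)"
    by (rule gen_binomial_complex) (use assms in simp)
  moreover have "((- a) gchoose n) * (- x) ^ n = pochhammer a n / fact n * x ^ n" for n
    by (subst power_minus) (simp add: gbinomial_pochhammer)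
  ultimately show ?thesis by simp
qed

lemma summable_norm_binomial_series:
  fixes a :: complex
  assumes "0 \<le> r" "r < 1"
  shows "summable (\<lambda>n. norm (pochhammer a n / fact n) * r ^ n)"
proof -
  let ?x = "complex_of_real ((r + 1) / 2)"
  have "norm ?x = (r + 1) / 2" using assms unfolding norm_of_real by simp
  then have x: "norm ?x < 1" "norm (complex_of_real r) < norm ?x" using assms by (auto simp del: of_real_divide of_real_add)
  from powser_insidea[OF sums_summable[OF sums_binomial_series[OF x(1), of a]] x(2)]
  show ?thesis using assms by (simp add: norm_mult norm_power norm_divide)
qed

lemma norm_sums_tail_le:
  fixes u :: "nat \<Rightarrow> complex"
  assumes "u sums s" "\<And>n. norm (u n) \<le> f n" "summable f"
  shows "norm (s - (\<Sum>n<N. u n)) \<le> suminf f - (\<Sum>n<N. f n)"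
proof (rule LIMSEQ_le)
  show "(\<lambda>M. norm ((\<Sum>n<M. u n) - (\<Sum>n<N. u n))) \<longlonglongrightarrow> norm (s - (\<Sum>n<N. u n))"
    using assms(1) unfolding sums_def by (intro tendsto_intros)
  show "(\<lambda>M. (\<Sum>n<M. f n) - (\<Sum>n<N. f n)) \<longlonglongrightarrow> suminf f - (\<Sum>n<N. f n)"
    using summable_sums[OF assms(3)] unfolding sums_def by (intro tendsto_intros)
  show "\<exists>M0. \<forall>M\<ge>M0. norm ((\<Sum>n<M. u n) - (\<Sum>n<N. u n)) \<le> (\<Sum>n<M. f n) - (\<Sum>n<N. f n)"
  proof (intro exI[of _ N] allI impI)
    fix M assume "N \<le> M"
    then have "(\<Sum>n<M. u n) - (\<Sum>n<N. u n) = (\<Sum>n=N..<M. u n)" "(\<Sum>n<M. f n) - (\<Sum>n<N. f n) = (\<Sum>n=N..<M. f n)"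
      using sum_diff_nat_ivl[of 0 N M u] sum_diff_nat_ivl[of 0 N M f] by (simp_all only: atLeast0LessThan)
    then show "norm ((\<Sum>n<M. u n) - (\<Sum>n<N. u n)) \<le> (\<Sum>n<M. f n) - (\<Sum>n<N. f n)"
      using assms(2) by (simp only: sum_norm_le)
  qed
qed

text \<open>
  The binomial series converges in $C^1$: the derivative of its remainder is $w$ times the
  remainder of the binomial series with exponent $-a-1$.
\<close>
lemma C1_bound_binomial_remainder:
  fixes a w :: complex
  assumes w: "norm w < 1"
  obtains A where "A \<longlonglongrightarrow> 0"
    "\<And>N. C1_bound (\<lambda>t. (1 - w * of_real t) powr (- a) - (\<Sum>n<Suc N. pochhammer a n / fact n * (w * of_real t) ^ n)) (A N)"
proof -
  define c where "c n = pochhammer a n / fact n" for n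
  define d where "d n = a * (pochhammer (a + 1) n / fact n)" for n
  define r where "r = norm w"
  have r: "0 \<le> r" "r < 1" using w by (auto simp: r_def)
  have cd: "of_nat (Suc n) * c (Suc n) = d n" for n
    by (simp add: c_def d_def pochhammer_rec[of a n] del: of_nat_Suc)
  have sc: "summable (\<lambda>n. norm (c n) * r ^ n)" unfolding c_def by (rule summable_norm_binomial_series[OF r])
  have sd: "summable (\<lambda>n. norm (d n) * r ^ n)"
    using summable_mult[OF summable_norm_binomial_series[OF r, of "a + 1"], of "norm a"]
    by (simp add: d_def norm_mult norm_divide mult.assoc)
  define T where "T f N = suminf f - (\<Sum>n<N. f n)" for f :: "nat \<Rightarrow> real" and N
  have T: "T f \<longlonglongrightarrow> 0" if "summable f" for f
    using tendsto_diff[OF tendsto_const[of "suminf f"] summable_LIMSEQ[OF that]] by (simp add: T_def[abs_def])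
  define A where "A N = T (\<lambda>n. norm (c n) * r ^ n) (Suc N) + r * T (\<lambda>n. norm (d n) * r ^ n) N" for N
  have T0: "0 \<le> T f N" if "summable f" "\<And>n. 0 \<le> f n" for f N
    unfolding T_def using sum_le_suminf[OF that(1), of "{..<N}"] that(2) by simp
  have pos: "0 \<le> T (\<lambda>n. norm (c n) * r ^ n) (Suc N)" "0 \<le> r * T (\<lambda>n. norm (d n) * r ^ n) N" for N
    using r by (auto intro!: T0 sc sd mult_nonneg_nonneg)
  show ?thesis
  proof (rule that[of A])
    have "(\<lambda>N. T (\<lambda>n. norm (c n) * r ^ n) (Suc N) + r * T (\<lambda>n. norm (d n) * r ^ n) N) \<longlonglongrightarrow> 0 + r * 0"
      by (intro tendsto_intros LIMSEQ_Suc T sc sd)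
    then show "A \<longlonglongrightarrow> 0" by (simp add: A_def[abs_def])
    fix N
    let ?R = "\<lambda>t. (1 - w * of_real t) powr (- a) - (\<Sum>n<Suc N. c n * (w * of_real t) ^ n)"
    let ?R' = "\<lambda>t. w * (a * (1 - w * of_real t) powr (- a - 1) - (\<Sum>n<N. d n * (w * of_real t) ^ n))"
    have wc: "w \<in> cut_plane" using w ball_subset_cut_plane by auto
    have "C1_bound ?R (A N)" unfolding C1_bound_def
    proof (intro exI[of _ ?R'] conjI ballI)
      have "continuous_on {0<..<1} (\<lambda>t::real. (\<lambda>(w, t). (1 - w * of_real t) powr (- a - 1)) (w, t))"
        by (rule continuous_on_compose2[OF continuous_on_binomial_kernel]) (use wc in \<open>auto intro!: continuous_intros\<close>)
      then have "continuous_on {0<..<1} (\<lambda>t::real. (1 - w * of_real t) powr (- a - 1))" by simp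
      moreover have "continuous_on {0<..<1} (\<lambda>t::real. \<Sum>n<N. d n * (w * of_real t) ^ n)"
        by (intro continuous_intros)
      ultimately show "continuous_on {0<..<1} ?R'"
        by (intro continuous_on_mult continuous_on_diff continuous_on_const)
    next
      fix t :: real assume t: "t \<in> {0<..<1}"
      have x: "norm (w * of_real t) \<le> r" "norm (w * of_real t) < 1"
      proof -
        show "norm (w * of_real t) \<le> r" using t by (simp add: norm_mult r_def mult_left_le)
        then show "norm (w * of_real t) < 1" using r by simp
      qed
      have "((\<lambda>t. \<Sum>n<Suc N. c n * (w * of_real t) ^ n) has_vector_derivative (\<Sum>n<Suc N. c n * (of_nat n * (w * of_real t) ^ (n - 1) * w))) (at t)"
        by (rule has_vector_derivative_real_field) (auto intro!: derivative_eq_intros sum.cong)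
      also have "(\<Sum>n<Suc N. c n * (of_nat n * (w * of_real t) ^ (n - 1) * w)) = (\<Sum>n<N. w * ((of_nat (Suc n) * c (Suc n)) * (w * of_real t) ^ n))"
        unfolding sum.lessThan_Suc_shift by (simp add: mult_ac)
      also have "\<dots> = w * (\<Sum>n<N. d n * (w * of_real t) ^ n)"
        unfolding cd by (simp add: sum_distrib_left)
      finally have S: "((\<lambda>t. \<Sum>n<Suc N. c n * (w * of_real t) ^ n) has_vector_derivative w * (\<Sum>n<N. d n * (w * of_real t) ^ n)) (at t)" .
      have "(?R has_vector_derivative (- w * (- a) * (1 - w * of_real t) powr (- a - 1) - w * (\<Sum>n<N. d n * (w * of_real t) ^ n))) (at t)"
        by (intro has_vector_derivative_diff S has_vector_derivative_binomial_kernel wc) (use t in auto)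
      then show "(?R has_vector_derivative ?R' t) (at t)" by (simp add: algebra_simps)
      have pw: "norm (w * of_real t) ^ n \<le> r ^ n" for n using x by (intro power_mono) auto
      have "norm (?R t) \<le> T (\<lambda>n. norm (c n) * r ^ n) (Suc N)"
        unfolding T_def c_def
        by (rule norm_sums_tail_le[OF sums_binomial_series[OF x(2)] _ sc[unfolded c_def]])
           (auto simp: norm_mult norm_power norm_divide intro!: mult_left_mono divide_right_mono pw[unfolded norm_mult, simplified])
      then show "norm (?R t) \<le> A N" using pos[of N] by (simp add: A_def)
      have "norm (a * (1 - w * of_real t) powr (- a - 1) - (\<Sum>n<N. d n * (w * of_real t) ^ n)) \<le> T (\<lambda>n. norm (d n) * r ^ n) N"
        unfolding T_def
      proof (rule norm_sums_tail_le[OF _ _ sd])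
        show "(\<lambda>n. d n * (w * of_real t) ^ n) sums (a * (1 - w * of_real t) powr (- a - 1))"
          using sums_mult[OF sums_binomial_series[OF x(2), of "a + 1"], of a] by (simp add: d_def mult.assoc)
        show "norm (d n * (w * of_real t) ^ n) \<le> norm (d n) * r ^ n" for n
          unfolding norm_mult[of "d n"] norm_power by (intro mult_left_mono pw) auto
      qed
      then have "norm (?R' t) \<le> r * T (\<lambda>n. norm (d n) * r ^ n) N"
        unfolding norm_mult[of w] r_def[symmetric] using r by (intro mult_left_mono) auto
      then show "norm (?R' t) \<le> A N" using pos[of N] by (simp add: A_def)
    qed
    then show "C1_bound (\<lambda>t. (1 - w * of_real t) powr (- a) - (\<Sum>n<Suc N. pochhammer a n / fact n * (w * of_real t) ^ n)) (A N)"
      by (simp add: c_def)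
  qed
qed

context C1_functional begin

text \<open>
  Termwise integration of the binomial series is legitimate although the integral converges only
  conditionally, because the functional is continuous for the $C^1$ norm in which the series
  converges.
\<close>
lemma binomial_transform_sums:
  assumes w: "norm w < 1"
  shows "(\<lambda>n. pochhammer a n / fact n * integral {0<..<1} (\<lambda>t. q t * of_real t ^ n) * w ^ n)
    sums integral {0<..<1} (\<lambda>t. q t * (1 - w * of_real t) powr (- a))"
proof -
  define c where "c n = pochhammer a n / fact n" for n
  obtain A where A: "A \<longlonglongrightarrow> 0"
    "\<And>N. C1_bound (\<lambda>t. (1 - w * of_real t) powr (- a) - (\<Sum>n<Suc N. c n * (w * of_real t) ^ n)) (A N)"
    by (rule C1_bound_binomial_remainder[OF w, of a, folded c_def], rule that)
  obtain M where M: "\<And>g A. C1_bound g A \<Longrightarrow> norm (integral {0<..<1} (\<lambda>t. q t * g t)) \<le> A * M"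
    by (rule bounded, rule that)
  let ?F = "integral {0<..<1} (\<lambda>t. q t * (1 - w * of_real t) powr (- a))"
  let ?m = "\<lambda>n. integral {0<..<1} (\<lambda>t. q t * of_real t ^ n)"
  have wc: "w \<in> cut_plane" using w ball_subset_cut_plane by auto
  obtain B where "C1_bound (\<lambda>t. (1 - w * of_real t) powr (- a)) B"
    using C1_bound_binomial_kernel[of "{w}" "- a"] wc by auto
  note int0 = truncation(1)[OF this]
  note intn = truncation(1)[OF C1_bound_power]
  have eq: "?F - (\<Sum>n<Suc N. c n * ?m n * w ^ n) =
      integral {0<..<1} (\<lambda>t. q t * ((1 - w * of_real t) powr (- a) - (\<Sum>n<Suc N. c n * (w * of_real t) ^ n)))" for N
  proof -
    have I: "((\<lambda>t. q t * (1 - w * of_real t) powr (- a) - (\<Sum>n<Suc N. c n * w ^ n * (q t * of_real t ^ n)))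
       has_integral (?F - (\<Sum>n<Suc N. c n * w ^ n * ?m n))) {0<..<1}"
      by (intro has_integral_diff has_integral_sum has_integral_mult_right integrable_integral int0 intn) auto
    have "(\<lambda>t. q t * (1 - w * of_real t) powr (- a) - (\<Sum>n<Suc N. c n * w ^ n * (q t * of_real t ^ n))) = 
       (\<lambda>t. q t * ((1 - w * of_real t) powr (- a) - (\<Sum>n<Suc N. c n * (w * of_real t) ^ n)))"
      by (simp add: right_diff_distrib sum_distrib_left power_mult_distrib mult_ac del: sum.lessThan_Suc)
    then show ?thesis using integral_unique[OF I] by (simp add: mult_ac del: sum.lessThan_Suc)
  qed
  have "(\<lambda>N. ?F - (\<Sum>n<Suc N. c n * ?m n * w ^ n)) \<longlonglongrightarrow> 0"
  proof (rule Lim_null_comparison)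
    show "\<forall>\<^sub>F N in sequentially. norm (?F - (\<Sum>n<Suc N. c n * ?m n * w ^ n)) \<le> A N * M"
      unfolding eq using M[OF A(2)] by (auto intro: always_eventually)
    show "(\<lambda>N. A N * M) \<longlonglongrightarrow> 0" using tendsto_mult_right[OF A(1), of M] by simp
  qed
  from tendsto_diff[OF tendsto_const[of ?F] this]
  have "(\<lambda>N. \<Sum>n<Suc N. c n * ?m n * w ^ n) \<longlonglongrightarrow> ?F" by (simp del: sum.lessThan_Suc)
  then have "(\<lambda>N. \<Sum>n<N. c n * ?m n * w ^ n) \<longlonglongrightarrow> ?F"
    by (rule filterlim_sequentially_Suc[where f = "\<lambda>N. \<Sum>n<N. c n * ?m n * w ^ n", THEN iffD1])
  then show ?thesis unfolding sums_def c_def .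
qed

lemma cut_continuation_binomial_transform:
  assumes "z \<in> cut_plane"
  shows "cut_continuation (\<lambda>n. pochhammer a n / fact n * (K * integral {0<..<1} (\<lambda>t. q t * of_real t ^ n))) z =
     K * integral {0<..<1} (\<lambda>t. q t * (1 - z * of_real t) powr (- a))"
proof (rule cut_continuation_eqI[OF _ _ assms])
  show "(\<lambda>w. K * integral {0<..<1} (\<lambda>t. q t * (1 - w * of_real t) powr (- a))) holomorphic_on cut_plane"
    by (intro holomorphic_on_mult holomorphic_on_const holomorphic_binomial_transform)
  fix w :: complex assume "w \<in> ball 0 1"
  then show "(\<lambda>n. pochhammer a n / fact n * (K * integral {0<..<1} (\<lambda>t. q t * of_real t ^ n)) * w ^ n) sums
      (K * integral {0<..<1} (\<lambda>t. q t * (1 - w * of_real t) powr (- a)))"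
    using sums_mult[OF binomial_transform_sums[of w a], of K] by (simp only: mem_ball dist_0_norm mult_ac)
qed

end

section \<open>Estimates at an end of the unit interval\<close>

lemma integral_powr_bound:
  fixes f :: "real \<Rightarrow> complex"
  assumes X: "X > 0" and de: "0 < d" "d \<le> e" and cont: "continuous_on {d..e} f"
    and bound: "\<And>t. t \<in> {d..e} \<Longrightarrow> norm (f t) \<le> B * t powr (X - 1)" and B: "0 \<le> B"
  shows "norm (integral {d..e} f) \<le> B * e powr X / X"
proof -
  have FTC: "((\<lambda>t. B * t powr (X - 1)) has_integral (B * e powr X / X - B * d powr X / X)) {d..e}"
    by (rule fundamental_theorem_of_calculus)
       (use X de in \<open>auto intro!: derivative_eq_intros simp: has_real_derivative_iff_has_vector_derivative[symmetric]\<close>)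
  have "norm (integral {d..e} f) \<le> integral {d..e} (\<lambda>t. B * t powr (X - 1))"
    by (rule integral_norm_bound_integral)
       (use FTC bound in \<open>auto intro: integrable_continuous_real[OF cont]\<close>)
  also have "\<dots> = B * e powr X / X - B * d powr X / X" by (rule integral_unique[OF FTC])
  also have "\<dots> \<le> B * e powr X / X" using B X by simp
  finally show ?thesis .
qed

lemma norm_of_real_powr: "t > 0 \<Longrightarrow> norm (complex_of_real t powr a) = t powr Re a"
  by (simp add: norm_powr_real_powr)

lemma continuous_on_of_real_powr:
  assumes "continuous_on A f" "\<And>t. t \<in> A \<Longrightarrow> f t > 0"
  shows "continuous_on A (\<lambda>t. complex_of_real (f t) powr a)"
proof -
  have "continuous_on A (\<lambda>t. exp (a * of_real (ln (f t))))"
    by (intro continuous_intros assms(1)) (use assms(2) in force)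
  then show ?thesis
    by (rule continuous_on_eq) (use assms(2) in \<open>force simp: powr_def Ln_of_real\<close>)
qed

lemma has_vector_derivative_of_real_powr:
  assumes "t > 0"
  shows "((\<lambda>t. complex_of_real t powr a) has_vector_derivative a * of_real t powr (a - 1)) (at t)"
  by (rule has_vector_derivative_real_field) (use assms in \<open>auto intro!: derivative_eq_intros\<close>)

lemma has_vector_derivative_of_real_one_minus_powr:
  assumes "t < 1"
  shows "((\<lambda>t. complex_of_real (1 - t) powr a) has_vector_derivative - a * of_real (1 - t) powr (a - 1)) (at t)"
proof -
  have "((\<lambda>x. (1 - x) powr a) has_field_derivative - a * (1 - of_real t) powr (a - 1)) (at (complex_of_real t))"
  proof -
    have "1 - complex_of_real t \<notin> \<real>\<^sub>\<le>\<^sub>0" using assms by (simp add: complex_nonpos_Reals_iff)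
    then show ?thesis by (auto intro!: derivative_eq_intros)
  qed
  then have "((\<lambda>t. (1 - complex_of_real t) powr a) has_vector_derivative - a * (1 - of_real t) powr (a - 1)) (at t)"
    by (rule has_vector_derivative_real_field)
  then show ?thesis by simp
qed

lemma of_real_quotient_powr:
  assumes "p > 0" "t > 0" "t < 1"
  shows "complex_of_real (p / (t * (1 - t))) powr a =
    of_real p powr a * of_real t powr (- a) * of_real (1 - t) powr (- a)"
proof -
  have pos: "p / (t * (1 - t)) > 0" "1 - t > 0" using assms by auto
  have "ln (p / (t * (1 - t))) = ln p - ln t - ln (1 - t)"
    using assms by (simp add: ln_div ln_mult)
  then have ln_eq: "complex_of_real (ln (p / (t * (1 - t)))) = of_real (ln p) - of_real (ln t) - of_real (ln (1 - t))"
    by simp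
  have P: "complex_of_real v powr c = exp (c * complex_of_real (ln v))" if "v > 0" for v c
    using that by (simp add: powr_def Ln_of_real)
  show ?thesis
    unfolding P[OF pos(1)] P[OF pos(2)] P[OF assms(1)] P[OF assms(2)] ln_eq exp_add[symmetric]
    by (rule arg_cong[where f = exp]) (simp add: algebra_simps)
qed

lemma of_real_powr_add_nat:
  assumes "t > 0"
  shows "complex_of_real t powr (x + of_nat n - 1) = of_real t powr (x - 1) * of_real t ^ n"
proof -
  have "complex_of_real t powr (x - 1 + of_nat n) = of_real t powr (x - 1) * of_real t powr of_nat n"
    by (rule powr_add)
  also have "complex_of_real t powr of_nat n = of_real t ^ n" using assms by (simp add: powr_nat')
  finally show ?thesis by (simp add: algebra_simps)
qed

text \<open>
  The reflection $t \mapsto 1-t$ turns the right end into the left end, so a kernel and its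
  reflection have to be examined only near $0$.
\<close>
lemma C1_functional_of_left_bounds:
  fixes q :: "real \<Rightarrow> complex"
  assumes cont: "continuous_on {0<..<1} q"
    and lim: "(\<sigma> \<longlongrightarrow> 0) (at_right 0)" "(\<sigma>' \<longlongrightarrow> 0) (at_right 0)"
    and nonneg: "\<And>e. 0 \<le> \<sigma> e" "\<And>e. 0 \<le> \<sigma>' e"
    and left: "\<And>g A d e. C1_bound g A \<Longrightarrow> 0 < d \<Longrightarrow> d \<le> e \<Longrightarrow> e \<le> 1/4 \<Longrightarrow> norm (integral {d..e} (\<lambda>t. q t * g t)) \<le> A * \<sigma> e"
    and left': "\<And>g A d e. C1_bound g A \<Longrightarrow> 0 < d \<Longrightarrow> d \<le> e \<Longrightarrow> e \<le> 1/4 \<Longrightarrow> norm (integral {d..e} (\<lambda>t. q (1 - t) * g t)) \<le> A * \<sigma>' e"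
  shows "C1_functional q (\<lambda>e. \<sigma> e + \<sigma>' e)"
proof
  show "continuous_on {0<..<1} q" by (rule cont)
  show "((\<lambda>e. \<sigma> e + \<sigma>' e) \<longlongrightarrow> 0) (at_right 0)" using tendsto_add[OF lim] by simp
next
  fix g A and d e :: real assume g: "C1_bound g A" and de: "0 < d" "d \<le> e" "e \<le> 1/4"
  note A = C1_bound_nonneg[OF g]
  have "A * \<sigma> e \<le> A * (\<sigma> e + \<sigma>' e)" using A nonneg by (intro mult_left_mono) auto
  then show "norm (integral {d..e} (\<lambda>t. q t * g t)) \<le> A * (\<sigma> e + \<sigma>' e)"
    using left[OF g de] by linarith
  have "integral {1 - e..1 - d} (\<lambda>t. q t * g t) = integral {d..e} (\<lambda>t. q (1 - t) * g (1 - t))"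
    using integral_reflect_unit[of e d "\<lambda>t. q (1 - t) * g (1 - t)"] by simp
  moreover have "A * \<sigma>' e \<le> A * (\<sigma> e + \<sigma>' e)" using A nonneg by (intro mult_left_mono) auto
  ultimately show "norm (integral {1 - e..1 - d} (\<lambda>t. q t * g t)) \<le> A * (\<sigma> e + \<sigma>' e)"
    using left'[OF C1_bound_reflect[OF g] de] by simp
qed

lemma powr_tendsto_0_at_right: "X > 0 \<Longrightarrow> ((\<lambda>e. C * e powr X) \<longlongrightarrow> 0) (at_right (0::real))"
proof -
  assume "X > 0"
  then have "((\<lambda>e. C * e powr X) \<longlongrightarrow> C * 0 powr X) (at_right 0)"
    by (intro tendsto_intros tendsto_powr') (auto simp: eventually_at_filter)
  then show ?thesis by simp
qed

section \<open>Kernels with a bounded primitive\<close>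

text \<open>
  The function \<open>H\<close> is an antiderivative of $v^{s-1}k(v)$. Its boundedness replaces any bound on
  \<open>k\<close> itself.
\<close>
locale oscillatory_kernel =
  fixes k H :: "real \<Rightarrow> complex" and s :: complex and M :: real
  assumes cont_k: "continuous_on {0<..} k"
    and H_deriv: "v > 0 \<Longrightarrow> (H has_vector_derivative of_real v powr (s - 1) * k v) (at v)"
    and H_bound: "v > 0 \<Longrightarrow> norm (H v) \<le> M"
begin

text \<open>
  The integrand of the Psi-beta function with \<open>k v\<close> in place of the Wright function at $-v$.
\<close>
definition psi_kernel :: "complex \<Rightarrow> complex \<Rightarrow> real \<Rightarrow> real \<Rightarrow> complex" where
  "psi_kernel x y p t = of_real t powr (x - 1) * of_real (1 - t) powr (y - 1) * k (p / (t * (1 - t)))"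

lemma continuous_on_psi_kernel:
  assumes "p > 0"
  shows "continuous_on {0<..<1} (psi_kernel x y p)"
  unfolding psi_kernel_def[abs_def]
  by (intro continuous_intros continuous_on_of_real_powr continuous_on_compose2[OF cont_k])
     (use assms in auto)

lemma M_nonneg: "0 \<le> M"
  using order_trans[OF norm_ge_zero H_bound[of 1]] by simp

text \<open>
  With $u = t(1-t)$ the chain rule gives
  $k(p/u) = -p^{-s}\,u^{s+1}/(1-2t)\cdot\frac{d}{dt}H(p/u)$. Integration by parts therefore reduces
  the integral to boundary terms and an integral that contain $H$ only undifferentiated; the
  remaining factor is $m(t)\,g(t)$ with $m(t) = t^{x+s}(1-t)^{y+s}/(1-2t)$. It is of size
  $t^{\mathrm{Re}(x+s)}$, and its derivative is of size $t^{\mathrm{Re}(x+s)-1}$, which is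
  integrable at $0$. Staying in $t \le 1/4$ keeps away from the zero of $1-2t$. The constant does
  not depend on $p$, and this is what makes the limit in the truncations uniform in $p$.
\<close>
lemma psi_kernel_left_bound:
  assumes X: "Re (x + s) > 0"
  obtains C where "C \<ge> 0"
    "\<And>p g A d e. p > 0 \<Longrightarrow> C1_bound g A \<Longrightarrow> 0 < d \<Longrightarrow> d \<le> e \<Longrightarrow> e \<le> 1/4 \<Longrightarrow>
       norm (integral {d..e} (\<lambda>t. psi_kernel x y p t * g t)) \<le> A * (C * p powr - Re s * e powr Re (x + s))"
proof -
  define X where "X = Re (x + s)"
  have X0: "X > 0" using assms by (simp add: X_def)
  define n where "n t = of_real (1 - t) powr (y + s) / of_real (1 - 2 * t)" for t
  define n' where "n' t = - (y + s) * of_real (1 - t) powr (y + s - 1) / of_real (1 - 2 * t)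
     + of_real (1 - t) powr (y + s) * 2 / (of_real (1 - 2 * t))\<^sup>2" for t
  have n_deriv: "(n has_vector_derivative n' t) (at t)" if "t < 1/2" for t
  proof -
    have nz: "1 - 2 * complex_of_real t \<noteq> 0"
    proof -
      have "complex_of_real (1 - 2 * t) \<noteq> 0" using that unfolding of_real_eq_0_iff by simp
      then show ?thesis by simp
    qed
    have "((\<lambda>x. inverse (1 - 2 * x)) has_field_derivative 2 / (1 - 2 * of_real t)\<^sup>2) (at (complex_of_real t))"
      using nz by (auto intro!: derivative_eq_intros simp: field_simps power2_eq_square)
    then have "((\<lambda>x. inverse (1 - 2 * complex_of_real x)) has_vector_derivative 2 / (1 - 2 * of_real t)\<^sup>2) (at t)"
      by (rule has_vector_derivative_real_field)
    from has_vector_derivative_mult[OF has_vector_derivative_of_real_one_minus_powr[of t "y + s"] this] that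
    have "((\<lambda>t. of_real (1 - t) powr (y + s) * inverse (1 - 2 * complex_of_real t)) has_vector_derivative
       of_real (1 - t) powr (y + s) * (2 / (1 - 2 * of_real t)\<^sup>2) +
       - (y + s) * of_real (1 - t) powr (y + s - 1) * inverse (1 - 2 * complex_of_real t)) (at t)" by simp
    then show ?thesis
      by (simp add: n_def[abs_def] n'_def divide_inverse add.commute mult.assoc)
  qed
  have c: "continuous_on {0..1/4} n" "continuous_on {0..1/4} n'"
    unfolding n_def[abs_def] n'_def[abs_def]
    by (intro continuous_intros continuous_on_of_real_powr; force simp: complex_eq_iff)+
  obtain B1 where B1: "\<forall>t\<in>{0..1/4}. norm (n t) \<le> B1"
    using compact_imp_bounded[OF compact_continuous_image[OF c(1) compact_Icc]] by (auto simp: bounded_iff)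
  obtain B2 where B2: "\<forall>t\<in>{0..1/4}. norm (n' t) \<le> B2"
    using compact_imp_bounded[OF compact_continuous_image[OF c(2) compact_Icc]] by (auto simp: bounded_iff)
  define B where "B = max B1 B2"
  have B: "norm (n t) \<le> B" "norm (n' t) \<le> B" if "t \<in> {0..1/4}" for t
    using B1 B2 that by (auto simp: B_def le_max_iff_disj)
  have B0: "0 \<le> B" using order_trans[OF norm_ge_zero B(1)[of 0]] by simp
  define L where "L = norm (x + s) + 2"
  have L0: "0 \<le> L" by (simp add: L_def)
  define C where "C = M * B * (2 + L / X)"
  have C0: "C \<ge> 0" using M_nonneg B0 L0 X0 by (simp add: C_def)
  define m where "m t = of_real t powr (x + s) * n t" for t
  define m' where "m' t = of_real t powr (x + s) * n' t + (x + s) * of_real t powr (x + s - 1) * n t" for t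
  have m_deriv: "(m has_vector_derivative m' t) (at t)" if "0 < t" "t < 1/2" for t
    unfolding m_def[abs_def] m'_def
    by (intro has_vector_derivative_mult has_vector_derivative_of_real_powr n_deriv that)
  have m_bound: "norm (m t) \<le> B * t powr X" and m'_bound: "norm (m' t) \<le> B * (L - 1) * t powr (X - 1)"
    if t: "0 < t" "t \<le> 1/4" for t
  proof -
    have b: "norm (n t) \<le> B" "norm (n' t) \<le> B" using B[of t] t by auto
    have e: "norm (complex_of_real t powr (x + s)) = t powr X" "norm (complex_of_real t powr (x + s - 1)) = t powr (X - 1)"
      using t norm_of_real_powr[of t] by (simp_all add: X_def)
    show "norm (m t) \<le> B * t powr X"
      unfolding m_def norm_mult e using mult_left_mono[OF b(1), of "t powr X"] by (simp add: mult.commute)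
    have "t powr X \<le> t powr (X - 1)" using t by (intro powr_mono') auto
    then have "t powr X * norm (n' t) \<le> t powr (X - 1) * B" using b(2) by (intro mult_mono) auto
    moreover have "norm (x + s) * t powr (X - 1) * norm (n t) \<le> norm (x + s) * t powr (X - 1) * B"
      using b(1) by (intro mult_left_mono) auto
    moreover have "norm (m' t) \<le> t powr X * norm (n' t) + norm (x + s) * t powr (X - 1) * norm (n t)"
      unfolding m'_def by (rule order_trans[OF norm_triangle_ineq]) (simp add: norm_mult e)
    ultimately have "norm (m' t) \<le> t powr (X - 1) * B + norm (x + s) * t powr (X - 1) * B" by linarith
    then show "norm (m' t) \<le> B * (L - 1) * t powr (X - 1)" by (simp add: L_def algebra_simps)
  qed
  show ?thesis
  proof (rule that[OF C0])
    fix p A d e :: real and g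
    assume p: "p > 0" and g: "C1_bound g A" and de: "0 < d" "d \<le> e" "e \<le> 1/4"
    obtain g' where g': "continuous_on {0<..<1} g'"
      "\<And>t. t \<in> {0<..<1} \<Longrightarrow> (g has_vector_derivative g' t) (at t)"
      "\<And>t. t \<in> {0<..<1} \<Longrightarrow> norm (g t) \<le> A" "\<And>t. t \<in> {0<..<1} \<Longrightarrow> norm (g' t) \<le> A"
      using g unfolding C1_bound_def by blast
    note A0 = C1_bound_nonneg[OF g]
    define u where "u t = t * (1 - t)" for t :: real
    have u: "u t > 0" if "t \<in> {d..e}" for t using that de by (auto simp: u_def)
    define E where "E t = H (p / u t)" for t
    define E' where "E' t = of_real (- p * (1 - 2 * t) / (u t)\<^sup>2) * (of_real (p / u t) powr (s - 1) * k (p / u t))" for t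
    have E_deriv: "(E has_vector_derivative E' t) (at t)" if "t \<in> {d..e}" for t
    proof -
      have "((\<lambda>t. p / u t) has_vector_derivative (- p * (1 - 2 * t) / (u t)\<^sup>2)) (at t)"
        unfolding u_def using u[OF that]
        by (auto simp: has_real_derivative_iff_has_vector_derivative[symmetric] u_def power2_eq_square field_simps intro!: derivative_eq_intros)
      from vector_diff_chain_at[OF this H_deriv[of "p / u t"]] u[OF that] p
      show ?thesis by (simp add: E_def[abs_def] E'_def o_def scaleR_conv_of_real)
    qed
    have cE: "continuous_on {d..e} E"
      by (rule continuous_at_imp_continuous_on) (auto intro: has_vector_derivative_continuous E_deriv)
    define G where "G t = m t * g t" for t
    define G' where "G' t = m t * g' t + m' t * g t" for t
    have G_deriv: "(G has_vector_derivative G' t) (at t)" if "t \<in> {d..e}" for t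
      unfolding G_def[abs_def] G'_def
      by (intro has_vector_derivative_mult m_deriv g') (use that de in auto)
    have G_bound: "norm (G t) \<le> A * B * e powr X" if "t \<in> {d..e}" for t
    proof -
      have "norm (G t) \<le> (B * t powr X) * A"
        unfolding G_def norm_mult using that de B0 by (intro mult_mono m_bound g') auto
      also have "\<dots> \<le> (B * e powr X) * A"
        using that de X0 A0 B0 by (intro mult_left_mono mult_right_mono powr_mono2) auto
      finally show ?thesis by (simp add: mult_ac)
    qed
    have G'_bound: "norm (G' t) \<le> A * B * L * t powr (X - 1)" if "t \<in> {d..e}" for t
    proof -
      have t: "0 < t" "t \<le> 1/4" using that de by auto
      have "t powr X \<le> t powr (X - 1)" using t by (intro powr_mono') auto
      then have "B * t powr X * A \<le> B * t powr (X - 1) * A" using A0 B0 by (intro mult_left_mono mult_right_mono) auto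
      moreover have "norm (m t) * norm (g' t) \<le> B * t powr X * A"
        using t B0 by (intro mult_mono m_bound g') auto
      moreover have "norm (m' t) * norm (g t) \<le> B * (L - 1) * t powr (X - 1) * A"
        using t B0 by (intro mult_mono m'_bound g') (auto simp: L_def)
      moreover have "norm (G' t) \<le> norm (m t) * norm (g' t) + norm (m' t) * norm (g t)"
        unfolding G'_def by (rule order_trans[OF norm_triangle_ineq]) (simp add: norm_mult)
      ultimately have "norm (G' t) \<le> B * t powr (X - 1) * A + B * (L - 1) * t powr (X - 1) * A" by linarith
      then show ?thesis by (simp add: algebra_simps)
    qed
    have sub: "{d..e} \<subseteq> {0<..<1}" using de by auto
    have cG': "continuous_on {d..e} G'"
    proof -
      have "continuous_on {d..e} m"
        by (rule continuous_at_imp_continuous_on) (use de in \<open>auto intro!: has_vector_derivative_continuous m_deriv\<close>)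
      moreover have "continuous_on {d..e} n" "continuous_on {d..e} n'"
        by (rule continuous_on_subset[OF c(1)], use de in auto) (rule continuous_on_subset[OF c(2)], use de in auto)
      moreover have "continuous_on {d..e} (\<lambda>t. complex_of_real t powr b)" for b
        by (rule continuous_on_of_real_powr) (use de in \<open>auto intro!: continuous_intros\<close>)
      ultimately show ?thesis
        unfolding G'_def[abs_def] m'_def
        by (intro continuous_on_add continuous_on_mult continuous_on_const continuous_on_subset[OF g'(1) sub]
             continuous_on_subset[OF C1_bound_continuous_on[OF g] sub])
    qed
    have key: "psi_kernel x y p t * g t = - (of_real p powr (- s)) * (G t * E' t)" if "t \<in> {d..e}" for t
    proof -
      have t: "0 < t" "t < 1/2" using that de by auto
      define a where "a = complex_of_real t"
      define b where "b = complex_of_real (1 - t)"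
      define P where "P = complex_of_real p"
      define w where "w = complex_of_real (1 - 2 * t)"
      have nz: "a \<noteq> 0" "b \<noteq> 0" "P \<noteq> 0" "w \<noteq> 0" using t p unfolding a_def b_def P_def w_def of_real_eq_0_iff by auto
      have 1: "of_real (p / u t) powr (s - 1) = P powr (s - 1) * a powr (- (s - 1)) * b powr (- (s - 1))"
        unfolding u_def a_def b_def P_def using t p by (intro of_real_quotient_powr) auto
      have 2: "a powr (x + s) = a powr (x - 1) * a * a powr s" "b powr (y + s) = b powr (y - 1) * b * b powr s"
        using nz powr_add[of a "x - 1" "1 + s"] powr_add[of a 1 s] powr_add[of b "y - 1" "1 + s"] powr_add[of b 1 s]
        by (simp_all add: mult.assoc)
      have 3: "c powr (- (s - 1)) = c / c powr s" if "c \<noteq> 0" for c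
        using that powr_diff[of c 1 s] by simp
      have 4: "P powr (s - 1) = P powr s / P" "P powr (- s) = 1 / P powr s"
        using nz powr_diff[of P s 1] by (simp_all add: powr_minus divide_inverse)
      have u2: "of_real (- p * (1 - 2 * t) / (u t)\<^sup>2) = - P * w / (a * b)\<^sup>2"
        unfolding u_def P_def w_def a_def b_def by simp
      have pn: "a powr s \<noteq> 0" "b powr s \<noteq> 0" "P powr s \<noteq> 0" using nz by auto
      have "- (P powr (- s)) * (G t * E' t) = 
         - (1 / P powr s) * ((a powr (x - 1) * a * a powr s * (b powr (y - 1) * b * b powr s / w) * g t) *
           (- P * w / (a * b)\<^sup>2 * (P powr s / P * (a / a powr s) * (b / b powr s) * k (p / u t))))"
        unfolding G_def m_def n_def E'_def u2 1 a_def[symmetric] b_def[symmetric] w_def[symmetric] 4 3[OF nz(1)] 3[OF nz(2)] 2 ..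
      also have "\<dots> = a powr (x - 1) * b powr (y - 1) * k (p / u t) * g t"
        using nz pn by (simp add: field_simps power2_eq_square)
      finally show ?thesis by (simp add: psi_kernel_def a_def b_def P_def u_def)
    qed
    have "((\<lambda>t. G t * E' t + G' t * E t) has_integral (G e * E e - G d * E d)) {d..e}"
    proof (rule fundamental_theorem_of_calculus)
      show "((\<lambda>t. G t * E t) has_vector_derivative G t * E' t + G' t * E t) (at t within {d..e})" if "t \<in> {d..e}" for t
        by (rule has_vector_derivative_at_within[OF has_vector_derivative_mult[OF G_deriv[OF that] E_deriv[OF that]]])
    qed (use de in simp)
    moreover have "((\<lambda>t. G' t * E t) has_integral integral {d..e} (\<lambda>t. G' t * E t)) {d..e}"
      by (intro integrable_integral integrable_continuous_real continuous_on_mult cG' cE)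
    ultimately have "((\<lambda>t. (G t * E' t + G' t * E t) - G' t * E t) has_integral 
        (G e * E e - G d * E d) - integral {d..e} (\<lambda>t. G' t * E t)) {d..e}"
      by (rule has_integral_diff)
    then have "((\<lambda>t. - (of_real p powr (- s)) * (G t * E' t)) has_integral 
        - (of_real p powr (- s)) * ((G e * E e - G d * E d) - integral {d..e} (\<lambda>t. G' t * E t))) {d..e}"
      by (intro has_integral_mult_right) simp
    then have J: "integral {d..e} (\<lambda>t. - (of_real p powr (- s)) * (G t * E' t)) =
        - (of_real p powr (- s)) * ((G e * E e - G d * E d) - integral {d..e} (\<lambda>t. G' t * E t))"
      by (rule integral_unique)
    have I: "integral {d..e} (\<lambda>t. psi_kernel x y p t * g t) = 
        - (of_real p powr (- s)) * ((G e * E e - G d * E d) - integral {d..e} (\<lambda>t. G' t * E t))"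
      unfolding J[symmetric] by (rule integral_cong) (rule key)
    have E_bound: "norm (E t) \<le> M" if "t \<in> {d..e}" for t
      unfolding E_def using H_bound[of "p / u t"] u[OF that] p by simp
    have GE: "norm (G t * E t) \<le> A * B * e powr X * M" if "t \<in> {d..e}" for t
      unfolding norm_mult using that A0 B0 by (intro mult_mono G_bound E_bound) auto
    have "norm (integral {d..e} (\<lambda>t. G' t * E t)) \<le> (A * B * L * M) * e powr X / X"
    proof (rule integral_powr_bound[OF X0 de(1,2)])
      show "continuous_on {d..e} (\<lambda>t. G' t * E t)" by (intro continuous_on_mult cG' cE)
      fix t assume t: "t \<in> {d..e}"
      have "norm (G' t * E t) \<le> (A * B * L * t powr (X - 1)) * M"
        unfolding norm_mult using t A0 B0 L0 by (intro mult_mono G'_bound E_bound) auto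
      then show "norm (G' t * E t) \<le> (A * B * L * M) * t powr (X - 1)" by (simp add: mult_ac)
    qed (use A0 B0 L0 M_nonneg in auto)
    moreover have "norm (G e * E e) \<le> A * B * e powr X * M" "norm (G d * E d) \<le> A * B * e powr X * M"
      using GE[of e] GE[of d] de by auto
    ultimately have "norm ((G e * E e - G d * E d) - integral {d..e} (\<lambda>t. G' t * E t)) \<le> 
        (A * B * e powr X * M + A * B * e powr X * M) + (A * B * L * M) * e powr X / X"
      by (intro order_trans[OF norm_triangle_ineq4] add_mono) auto
    also have "\<dots> = A * (C * e powr X)" by (simp add: C_def algebra_simps)
    finally have "norm ((G e * E e - G d * E d) - integral {d..e} (\<lambda>t. G' t * E t)) \<le> A * (C * e powr X)" .
    then have "p powr - Re s * norm ((G e * E e - G d * E d) - integral {d..e} (\<lambda>t. G' t * E t)) \<le> p powr - Re s * (A * (C * e powr X))"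
      by (intro mult_left_mono) auto
    then show "norm (integral {d..e} (\<lambda>t. psi_kernel x y p t * g t)) \<le> A * (C * p powr - Re s * e powr Re (x + s))"
      unfolding I norm_mult norm_minus_cancel norm_of_real_powr[OF p] X_def[symmetric] by (simp add: mult_ac)
  qed
qed

lemma psi_kernel_C1_functional:
  assumes X: "Re (x + s) > 0" and Y: "Re (y + s) > 0"
  obtains \<sigma> :: "real \<Rightarrow> real" where "\<And>p. p > 0 \<Longrightarrow> C1_functional (psi_kernel x y p) (\<lambda>e. p powr - Re s * \<sigma> e)"
    "(\<sigma> \<longlongrightarrow> 0) (at_right 0)" "\<And>e. 0 \<le> \<sigma> e"
proof -
  obtain C where C: "C \<ge> 0"
    "\<And>p g A d e. p > 0 \<Longrightarrow> C1_bound g A \<Longrightarrow> 0 < d \<Longrightarrow> d \<le> e \<Longrightarrow> e \<le> 1/4 \<Longrightarrow>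
       norm (integral {d..e} (\<lambda>t. psi_kernel x y p t * g t)) \<le> A * (C * p powr - Re s * e powr Re (x + s))"
    by (rule psi_kernel_left_bound[OF X, of y], rule that)
  obtain C' where C': "C' \<ge> 0"
    "\<And>p g A d e. p > 0 \<Longrightarrow> C1_bound g A \<Longrightarrow> 0 < d \<Longrightarrow> d \<le> e \<Longrightarrow> e \<le> 1/4 \<Longrightarrow>
       norm (integral {d..e} (\<lambda>t. psi_kernel y x p t * g t)) \<le> A * (C' * p powr - Re s * e powr Re (y + s))"
    by (rule psi_kernel_left_bound[OF Y, of x], rule that)
  have refl: "psi_kernel x y p (1 - t) = psi_kernel y x p t" for p t by (simp add: psi_kernel_def mult_ac)
  show ?thesis
  proof (rule that[of "\<lambda>e. C * e powr Re (x + s) + C' * e powr Re (y + s)"])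
    fix p :: real assume p: "p > 0"
    have "C1_functional (psi_kernel x y p) (\<lambda>e. C * p powr - Re s * e powr Re (x + s) + C' * p powr - Re s * e powr Re (y + s))"
    proof (rule C1_functional_of_left_bounds)
      show "continuous_on {0<..<1} (psi_kernel x y p)" by (rule continuous_on_psi_kernel[OF p])
      show "((\<lambda>e. C * p powr - Re s * e powr Re (x + s)) \<longlongrightarrow> 0) (at_right 0)"
        "((\<lambda>e. C' * p powr - Re s * e powr Re (y + s)) \<longlongrightarrow> 0) (at_right 0)"
        using X Y by (intro powr_tendsto_0_at_right; simp)+
      show "0 \<le> C * p powr - Re s * e powr Re (x + s)" "0 \<le> C' * p powr - Re s * e powr Re (y + s)" for e
        using C(1) C'(1) by simp_all
      fix g A and d e :: real
      assume g: "C1_bound g A" and de: "0 < d" "d \<le> e" "e \<le> 1/4"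
      show "norm (integral {d..e} (\<lambda>t. psi_kernel x y p t * g t)) \<le> A * (C * p powr - Re s * e powr Re (x + s))"
        by (rule C(2)[OF p g de])
      show "norm (integral {d..e} (\<lambda>t. psi_kernel x y p (1 - t) * g t)) \<le> A * (C' * p powr - Re s * e powr Re (y + s))"
        unfolding refl by (rule C'(2)[OF p g de])
    qed
    then show "C1_functional (psi_kernel x y p) (\<lambda>e. p powr - Re s * (C * e powr Re (x + s) + C' * e powr Re (y + s)))"
      by (simp add: algebra_simps)
  next
    show "((\<lambda>e. C * e powr Re (x + s) + C' * e powr Re (y + s)) \<longlongrightarrow> 0) (at_right 0)"
      using tendsto_add[OF powr_tendsto_0_at_right[OF X, of C] powr_tendsto_0_at_right[OF Y, of C']] by simp
    show "0 \<le> C * e powr Re (x + s) + C' * e powr Re (y + s)" for e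
      using C(1) C'(1) by simp
  qed
qed

end

section \<open>The complex beta integral and the Euler integral\<close>

lemma beta_kernel_C1_functional:
  assumes X: "Re x > 0" and Y: "Re y > 0"
  obtains \<sigma> where "C1_functional (\<lambda>t. of_real t powr (x - 1) * of_real (1 - t) powr (y - 1)) \<sigma>"
proof -
  define q where "q x y t = complex_of_real t powr (x - 1) * complex_of_real (1 - t) powr (y - 1)" for x y t
  have cont: "continuous_on {0<..<1} (q x y)" for x y
    unfolding q_def[abs_def] by (intro continuous_on_mult continuous_on_of_real_powr continuous_intros) auto
  have bound: "\<exists>C\<ge>0. \<forall>g A d e. C1_bound g A \<longrightarrow> 0 < d \<longrightarrow> d \<le> e \<longrightarrow> e \<le> 1/4 \<longrightarrow>
      norm (integral {d..e} (\<lambda>t. q x y t * g t)) \<le> A * (C * e powr Re x)" if X: "Re x > 0" for x y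
  proof -
    have c: "continuous_on {0..1/4} (\<lambda>t. complex_of_real (1 - t) powr (y - 1))"
      by (intro continuous_on_of_real_powr continuous_intros) auto
    obtain B where B: "\<forall>t\<in>{0..1/4}. norm (complex_of_real (1 - t) powr (y - 1)) \<le> B"
      using compact_imp_bounded[OF compact_continuous_image[OF c compact_Icc]] by (auto simp: bounded_iff)
    have B0: "0 \<le> B" using order_trans[OF norm_ge_zero B[rule_format, of 0]] by simp
    have "norm (integral {d..e} (\<lambda>t. q x y t * g t)) \<le> A * (B / Re x * e powr Re x)"
      if g: "C1_bound g A" and de: "0 < d" "d \<le> e" "e \<le> 1/4" for g A d e
    proof -
      note A0 = C1_bound_nonneg[OF g]
      have sub: "{d..e} \<subseteq> {0<..<1}" using de by auto
      have "norm (integral {d..e} (\<lambda>t. q x y t * g t)) \<le> (B * A) * e powr Re x / Re x"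
      proof (rule integral_powr_bound[OF X de(1,2)])
        show "continuous_on {d..e} (\<lambda>t. q x y t * g t)"
          by (intro continuous_on_mult continuous_on_subset[OF cont sub] continuous_on_subset[OF C1_bound_continuous_on[OF g] sub])
        show "0 \<le> B * A" using A0 B0 by simp
        fix t assume t: "t \<in> {d..e}"
        then have t': "t \<in> {0..1/4}" "t \<in> {0<..<1}" "t > 0" using de by auto
        have "norm (g t) \<le> A" using g t' unfolding C1_bound_def by blast
        then have "norm (q x y t * g t) \<le> (t powr (Re x - 1) * B) * A"
          unfolding q_def norm_mult norm_of_real_powr[OF t'(3)] using B[rule_format, OF t'(1)] B0
          by (intro mult_mono) (simp_all add: mult_left_mono)
        then show "norm (q x y t * g t) \<le> B * A * t powr (Re x - 1)" by (simp add: mult_ac)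
      qed
      then show ?thesis by (simp add: mult_ac)
    qed
    then show ?thesis using B0 X by (intro exI[of _ "B / Re x"]) simp
  qed
  obtain C where C: "C \<ge> 0" "\<And>g A d e. C1_bound g A \<Longrightarrow> 0 < d \<Longrightarrow> d \<le> e \<Longrightarrow> e \<le> 1/4 \<Longrightarrow>
      norm (integral {d..e} (\<lambda>t. q x y t * g t)) \<le> A * (C * e powr Re x)"
    using bound[OF X, of y] by blast
  obtain C' where C': "C' \<ge> 0" "\<And>g A d e. C1_bound g A \<Longrightarrow> 0 < d \<Longrightarrow> d \<le> e \<Longrightarrow> e \<le> 1/4 \<Longrightarrow>
      norm (integral {d..e} (\<lambda>t. q y x t * g t)) \<le> A * (C' * e powr Re y)"
    using bound[OF Y, of x] by blast
  have refl: "q x y (1 - t) = q y x t" for t by (simp add: q_def mult_ac)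
  have "C1_functional (q x y) (\<lambda>e. C * e powr Re x + C' * e powr Re y)"
  proof (rule C1_functional_of_left_bounds)
    show "continuous_on {0<..<1} (q x y)" by (rule cont)
    show "((\<lambda>e. C * e powr Re x) \<longlongrightarrow> 0) (at_right 0)" "((\<lambda>e. C' * e powr Re y) \<longlongrightarrow> 0) (at_right 0)"
      by (rule powr_tendsto_0_at_right[OF X], rule powr_tendsto_0_at_right[OF Y])
    show "0 \<le> C * e powr Re x" "0 \<le> C' * e powr Re y" for e using C(1) C'(1) by simp_all
    fix g A and d e :: real
    assume g: "C1_bound g A" and de: "0 < d" "d \<le> e" "e \<le> 1/4"
    show "norm (integral {d..e} (\<lambda>t. q x y t * g t)) \<le> A * (C * e powr Re x)" by (rule C(2)[OF g de])
    show "norm (integral {d..e} (\<lambda>t. q x y (1 - t) * g t)) \<le> A * (C' * e powr Re y)"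
      unfolding refl by (rule C'(2)[OF g de])
  qed
  then show ?thesis unfolding q_def[abs_def] by (rule that)
qed

definition beta_integral :: "complex \<Rightarrow> complex \<Rightarrow> complex" where
  "beta_integral x y = integral {0<..<1} (\<lambda>t::real. of_real t powr (x - 1) * of_real (1 - t) powr (y - 1))"

lemma C1_bound_const_one: "C1_bound (\<lambda>_. 1) 1"
  unfolding C1_bound_def by (intro exI[of _ "\<lambda>_. 0"]) auto

lemma beta_kernel_integrable:
  assumes "Re x > 0" "Re y > 0"
  shows "(\<lambda>t. complex_of_real t powr (x - 1) * of_real (1 - t) powr (y - 1)) integrable_on {0<..<1}"
proof -
  obtain \<sigma> where "C1_functional (\<lambda>t. of_real t powr (x - 1) * of_real (1 - t) powr (y - 1)) \<sigma>"
    by (rule beta_kernel_C1_functional[OF assms])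
  from C1_functional.truncation(1)[OF this C1_bound_const_one] show ?thesis by simp
qed

lemma beta_integral_commute: "beta_integral x y = beta_integral y x"
proof -
  let ?f = "\<lambda>x y t. complex_of_real t powr (x - 1) * of_real (1 - t) powr (y - 1)"
  have "integral {0..1} (?f x y) = integral {0..1} (\<lambda>t. ?f x y (1 - t))"
    using integral_reflect_unit[of 1 0 "?f x y"] by simp
  also have "(\<lambda>t. ?f x y (1 - t)) = ?f y x" by (simp add: fun_eq_iff mult.commute)
  finally show ?thesis unfolding beta_integral_def integral_open_interval_real .
qed

lemma real_beta_integrable:
  assumes "a > 0" "b > (0::real)"
  shows "(\<lambda>t. t powr (a - 1) * (1 - t) powr (b - 1)) integrable_on {0<..<1}"
  using has_integral_Beta_real[OF assms] unfolding has_integral_Icc_iff_Ioo by blast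

lemma beta_integral_of_real:
  assumes "a > 0" "b > 0"
  shows "beta_integral (of_real a) (of_real b) = Beta (of_real a) (of_real b)"
proof -
  have "((\<lambda>t. t powr (a - 1) * (1 - t) powr (b - 1)) has_integral Beta a b) {0<..<1}"
    using has_integral_Beta_real[OF assms] unfolding has_integral_Icc_iff_Ioo .
  then have "((\<lambda>t. complex_of_real (t powr (a - 1) * (1 - t) powr (b - 1))) has_integral of_real (Beta a b)) {0<..<1}"
    by (rule has_integral_linear[OF _ bounded_linear_of_real, unfolded o_def])
  then have "((\<lambda>t. of_real t powr (of_real a - 1) * of_real (1 - t) powr (of_real b - 1)) has_integral complex_of_real (Beta a b)) {0<..<1}"
  proof (rule has_integral_eq[rotated])
    fix t :: real assume t: "t \<in> {0<..<1}"
    have "complex_of_real t powr of_real c = of_real (t powr c)" "complex_of_real (1 - t) powr of_real c = of_real ((1 - t) powr c)" for c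
      by (rule powr_of_real, use t in simp)+
    from this(1)[of "a - 1"] this(2)[of "b - 1"]
    show "complex_of_real (t powr (a - 1) * (1 - t) powr (b - 1)) = of_real t powr (of_real a - 1) * of_real (1 - t) powr (of_real b - 1)"
      by simp
  qed
  then show ?thesis unfolding beta_integral_def Beta_complex_of_real by (rule integral_unique)
qed

text \<open>
  On a disc of radius $\mathrm{Re}(z)/2$ about $z$ all the integrands are dominated by a single
  real beta integrand.
\<close>
lemma beta_integral_holomorphic:
  assumes Y: "Re y > 0"
  shows "(\<lambda>x. beta_integral x y) holomorphic_on {x. Re x > 0}"
  unfolding beta_integral_def
proof (rule holomorphic_improper_integral)
  show "open {x. Re x > 0}" by (rule open_halfspace_Re_gt)
next
  fix w :: complex and t :: real assume "w \<in> {x. Re x > 0}" "t \<in> {0<..<1}"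
  then have "complex_of_real t \<noteq> 0" by simp
  then have "((\<lambda>w. of_real t powr (w - 1)) has_field_derivative of_real t powr (w - 1) * Ln (of_real t)) (at w)"
    unfolding powr_def by (auto intro!: derivative_eq_intros)
  then show "((\<lambda>w. of_real t powr (w - 1) * of_real (1 - t) powr (y - 1)) has_field_derivative
     of_real t powr (w - 1) * Ln (of_real t) * of_real (1 - t) powr (y - 1)) (at w)"
    by (rule DERIV_cmult_right)
next
  have 1: "continuous_on ({x. Re x > 0} \<times> {0<..<1}) (\<lambda>z. complex_of_real (snd z) powr (fst z - 1))"
  proof -
    have "continuous_on ({x. Re x > 0} \<times> {0<..<1}) (\<lambda>z. exp ((fst z - 1) * of_real (ln (snd z))))"
      by (intro continuous_intros) auto
    then show ?thesis by (rule continuous_on_eq) (auto simp: powr_def Ln_of_real)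
  qed
  have 2: "continuous_on ({x. Re x > 0} \<times> {0<..<1}) (\<lambda>z::complex \<times> real. complex_of_real (1 - snd z) powr (y - 1))"
    by (rule continuous_on_of_real_powr) (auto intro!: continuous_intros)
  have 3: "continuous_on ({x. Re x > 0} \<times> {0<..<1}) (\<lambda>z::complex \<times> real. Ln (complex_of_real (snd z)))"
    by (intro continuous_intros) auto
  show "continuous_on ({x. Re x > 0} \<times> {0<..<1}) (\<lambda>(w, t). complex_of_real t powr (w - 1) * of_real (1 - t) powr (y - 1))"
    "continuous_on ({x. Re x > 0} \<times> {0<..<1}) (\<lambda>(w, t). complex_of_real t powr (w - 1) * Ln (of_real t) * of_real (1 - t) powr (y - 1))"
    unfolding case_prod_unfold by (intro continuous_on_mult 1 2 3)+
next
  fix z :: complex assume "z \<in> {x. Re x > 0}"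
  then have z: "Re z > 0" by simp
  define r where "r = Re z / 2"
  have r: "r > 0" using z by (simp add: r_def)
  have Re_w: "r \<le> Re w" if "w \<in> cball z r" for w
    using abs_Re_le_cmod[of "z - w"] that by (simp add: dist_norm r_def)
  define f where "f t = t powr (r - 1) * (1 - t) powr (Re y - 1)" for t
  have int_f: "f integrable_on {0<..<1}" unfolding f_def[abs_def] by (rule real_beta_integrable[OF r Y])
  have int_f': "f integrable_on {0..1}" using int_f by (simp add: integrable_on_open_interval_real)
  define \<tau> where "\<tau> e = integral {0<..<1} f - integral {e..1 - e} f" for e
  have lim: "(\<tau> \<longlongrightarrow> 0) (at_right 0)"
    using tendsto_diff[OF tendsto_const[of "integral {0<..<1} f"] truncated_integral_tendsto[OF int_f]]
    by (simp add: \<tau>_def[abs_def])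
  have tail: "norm (integral {0<..<1} g - integral {e..1 - e} g) \<le> \<tau> e"
    if g: "g integrable_on {0<..<1}" and le: "\<And>t. t \<in> {0<..<1} \<Longrightarrow> norm (g t) \<le> f t" and e: "e \<in> {0<..1/4}" for g :: "real \<Rightarrow> complex" and e
  proof -
    have g': "g integrable_on {0..1}" using g by (simp add: integrable_on_open_interval_real)
    have split: "integral {0<..<1} h = integral {0<..<e} h + integral {e..1 - e} h + integral {1 - e<..<1} h"
      if "h integrable_on {0..1}" for h :: "real \<Rightarrow> 'b::euclidean_space"
    proof -
      have "h integrable_on {0..1 - e}" by (rule integrable_on_subinterval[OF that]) (use e in auto)
      then show ?thesis
        using Henstock_Kurzweil_Integration.integral_combine[OF _ _ that, of "1 - e"]
          Henstock_Kurzweil_Integration.integral_combine[of 0 e "1 - e" h] e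
        by (simp add: integral_open_interval_real[symmetric])
    qed
    have sub: "h integrable_on {0<..<e}" "h integrable_on {1 - e<..<1}" if "h integrable_on {0..1}" for h :: "real \<Rightarrow> 'b::euclidean_space"
      unfolding integrable_on_open_interval_real
      by (rule integrable_on_subinterval[OF that], use e in auto)+
    have "norm (integral {0<..<e} g) \<le> integral {0<..<e} f"
      by (rule integral_norm_bound_integral[OF sub(1)[OF g'] sub(1)[OF int_f']]) (use le e in auto)
    moreover have "norm (integral {1 - e<..<1} g) \<le> integral {1 - e<..<1} f"
      by (rule integral_norm_bound_integral[OF sub(2)[OF g'] sub(2)[OF int_f']]) (use le e in auto)
    moreover have "\<tau> e = integral {0<..<e} f + integral {1 - e<..<1} f"
      using split[OF int_f'] by (simp add: \<tau>_def)
    moreover have "norm (integral {0<..<1} g - integral {e..1 - e} g) \<le> norm (integral {0<..<e} g) + norm (integral {1 - e<..<1} g)"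
      using norm_triangle_ineq[of "integral {0<..<e} g" "integral {1 - e<..<1} g"] by (simp add: split[OF g'])
    ultimately show ?thesis by linarith
  qed
  show "\<exists>r>0. cball z r \<subseteq> {x. Re x > 0} \<and> (\<exists>\<tau>. (\<tau> \<longlongrightarrow> 0) (at_right 0) \<and>
      (\<forall>w\<in>cball z r. \<forall>e\<in>{0<..1/4}. norm (integral {0<..<1} (\<lambda>t. of_real t powr (w - 1) * of_real (1 - t) powr (y - 1)) - 
         integral {e..1 - e} (\<lambda>t. of_real t powr (w - 1) * of_real (1 - t) powr (y - 1))) \<le> \<tau> e))"
  proof (intro exI[of _ r] exI[of _ \<tau>] conjI ballI r lim)
    show "cball z r \<subseteq> {x. Re x > 0}" using Re_w r by force
    fix w e assume w: "w \<in> cball z r" and e: "e \<in> {0<..1/4::real}"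
    show "norm (integral {0<..<1} (\<lambda>t. of_real t powr (w - 1) * of_real (1 - t) powr (y - 1)) - 
         integral {e..1 - e} (\<lambda>t. of_real t powr (w - 1) * of_real (1 - t) powr (y - 1))) \<le> \<tau> e"
    proof (rule tail[OF _ _ e])
      show "(\<lambda>t. complex_of_real t powr (w - 1) * of_real (1 - t) powr (y - 1)) integrable_on {0<..<1}"
        using Re_w[OF w] r by (intro beta_kernel_integrable Y) auto
      fix t :: real assume t: "t \<in> {0<..<1}"
      then have "t powr (Re w - 1) \<le> t powr (r - 1)" using Re_w[OF w] by (intro powr_mono') auto
      then show "norm (complex_of_real t powr (w - 1) * of_real (1 - t) powr (y - 1)) \<le> f t"
        using t norm_of_real_powr[of t "w - 1"] norm_of_real_powr[of "1 - t" "y - 1"] unfolding norm_mult f_def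
        by (intro mult_mono) auto
    qed
  qed
qed

lemma Beta_holomorphic_halfplane:
  assumes "Re y > 0"
  shows "(\<lambda>x. Beta x y) holomorphic_on {x. Re x > 0}"
proof -
  have "z \<notin> \<int>\<^sub>\<le>\<^sub>0" if "Re z > 0" for z :: complex
    using that by (auto elim!: nonpos_Ints_cases)
  then show ?thesis
    using assms by (intro holomorphic_Beta holomorphic_on_ident holomorphic_on_const) auto
qed

text \<open>
  The real case extends by the identity theorem, first in one argument with the other one real, and
  then in the other argument.
\<close>
theorem beta_integral_eq_Beta:
  assumes X: "Re x > 0" and Y: "Re y > 0"
  shows "beta_integral x y = Beta x y"
proof -
  have islimpt: "1 islimpt (complex_of_real ` {0<..})"
  proof -
    have "(\<lambda>n. complex_of_real (1 + inverse (real (Suc n)))) \<longlonglongrightarrow> of_real (1 + 0)"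
      by (intro tendsto_intros LIMSEQ_inverse_real_of_nat)
    moreover have "complex_of_real (1 + inverse (real (Suc n))) \<in> complex_of_real ` {0<..} - {1}" for n
      by (auto simp: add_pos_pos simp del: of_nat_Suc of_real_add)
    ultimately show ?thesis unfolding islimpt_sequential by (intro exI[of _ "\<lambda>n. complex_of_real (1 + inverse (real (Suc n)))"]) auto
  qed
  have ext: "f x = g x" if "f holomorphic_on {x. Re x > 0}" "g holomorphic_on {x. Re x > 0}" 
      "\<And>a. a > 0 \<Longrightarrow> f (of_real a) = g (of_real a)" "Re x > 0" for f g :: "complex \<Rightarrow> complex" and x
  proof -
    have "f x - g x = 0"
      by (rule analytic_continuation[of "\<lambda>x. f x - g x" "{x. Re x > 0}" "complex_of_real ` {0<..}" 1])
         (use that islimpt in \<open>auto intro!: holomorphic_intros open_halfspace_Re_gt convex_connected convex_halfspace_Re_gt\<close>)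
    then show ?thesis by simp
  qed
  have real: "beta_integral (of_real a) y = Beta (of_real a) y" if "a > 0" for a
  proof -
    have "beta_integral y (of_real a) = Beta y (of_real a)"
      by (rule ext[OF beta_integral_holomorphic Beta_holomorphic_halfplane])
         (use that Y beta_integral_of_real in auto)
    then show ?thesis by (simp add: beta_integral_commute[of "of_real a"] Beta_commute[of "of_real a"])
  qed
  show ?thesis
    by (rule ext[OF beta_integral_holomorphic[OF Y] Beta_holomorphic_halfplane[OF Y] real X])
qed

lemma not_nonpos_Ints_of_Re_pos: "Re z > 0 \<Longrightarrow> z \<notin> \<int>\<^sub>\<le>\<^sub>0"
  by (auto elim!: nonpos_Ints_cases)

lemma Beta_add_of_nat:
  assumes "Re x > 0" "Re y > 0"
  shows "Beta (x + of_nat n) y = Beta x y * (pochhammer x n / pochhammer (x + y) n)"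
proof -
  have x: "x \<notin> \<int>\<^sub>\<le>\<^sub>0" "x + y \<notin> \<int>\<^sub>\<le>\<^sub>0" using assms by (auto intro!: not_nonpos_Ints_of_Re_pos)
  have "rGamma (x + y) = pochhammer (x + y) n * rGamma (x + of_nat n + y)"
    using pochhammer_rGamma[of "x + y" n] by (simp add: add_ac)
  moreover have "pochhammer (x + y) n \<noteq> 0" using x(2) pochhammer_eq_0_imp_nonpos_Int by blast
  ultimately have "rGamma (x + of_nat n + y) = rGamma (x + y) / pochhammer (x + y) n" by simp
  moreover have "Gamma (x + of_nat n) = pochhammer x n * Gamma x"
    using pochhammer_Gamma[OF x(1), of n] x(1) by (simp add: Gamma_eq_zero_iff)
  ultimately show ?thesis by (simp add: Beta_altdef)
qed

lemma Beta_nonzero: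
  assumes "Re x > 0" "Re y > 0"
  shows "Beta x y \<noteq> 0"
proof -
  have "x \<notin> \<int>\<^sub>\<le>\<^sub>0" "y \<notin> \<int>\<^sub>\<le>\<^sub>0" "x + y \<notin> \<int>\<^sub>\<le>\<^sub>0"
    by (rule not_nonpos_Ints_of_Re_pos, use assms in simp)+
  then show ?thesis by (simp add: Beta_altdef Gamma_eq_zero_iff rGamma_eq_zero_iff)
qed

text \<open>
  The moments of the beta kernel are $B(x+n,y) = B(x,y)\,(x)_n/(x+y)_n$, so its binomial transform
  continues $B(x,y)$ times the Gauss series.
\<close>
theorem gauss_hypergeo_Euler_integral:
  assumes X: "Re x > 0" and Y: "Re y > 0" and z: "z \<in> cut_plane"
  shows "Beta x y * gauss_hypergeo a x (x + y) z =
    integral {0<..<1} (\<lambda>t. of_real t powr (x - 1) * of_real (1 - t) powr (y - 1) * (1 - z * of_real t) powr (- a))"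
proof -
  let ?q = "\<lambda>t. complex_of_real t powr (x - 1) * of_real (1 - t) powr (y - 1)"
  obtain \<sigma> where "C1_functional ?q \<sigma>" by (rule beta_kernel_C1_functional[OF X Y])
  then interpret C1_functional ?q \<sigma> .
  have "integral {0<..<1} (\<lambda>t. ?q t * of_real t ^ n) = Beta x y * (pochhammer x n / pochhammer (x + y) n)" for n
  proof -
    have "integral {0<..<1} (\<lambda>t. ?q t * of_real t ^ n) = beta_integral (x + of_nat n) y"
      unfolding beta_integral_def by (rule integral_cong) (simp add: of_real_powr_add_nat)
    also have "\<dots> = Beta x y * (pochhammer x n / pochhammer (x + y) n)"
      using X Y by (simp add: beta_integral_eq_Beta Beta_add_of_nat)
    finally show ?thesis .
  qed
  then have "(\<lambda>n. pochhammer a n * pochhammer x n / (pochhammer (x + y) n * fact n)) =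
      (\<lambda>n. pochhammer a n / fact n * (1 / Beta x y * integral {0<..<1} (\<lambda>t. ?q t * of_real t ^ n)))"
    using Beta_nonzero[OF X Y] by (simp add: fun_eq_iff)
  then have "gauss_hypergeo a x (x + y) z = 1 / Beta x y * integral {0<..<1} (\<lambda>t. ?q t * (1 - z * of_real t) powr (- a))"
    unfolding gauss_hypergeo_def by (simp only: cut_continuation_binomial_transform[OF z])
  then show ?thesis using Beta_nonzero[OF X Y] by simp
qed

section \<open>The Mellin transform\<close>

lemma integrable_continuous_dominated:
  fixes f :: "real \<Rightarrow> complex"
  assumes "continuous_on {0<..<1} f" "f0 integrable_on {0<..<1}" "\<And>t. t \<in> {0<..<1} \<Longrightarrow> norm (f t) \<le> f0 t"
  shows "f integrable_on {0<..<1}"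
proof (rule measurable_bounded_by_integrable_imp_integrable[OF _ assms(2)])
  show "f \<in> borel_measurable (lebesgue_on {0<..<1})"
    by (rule continuous_imp_measurable_on_sets_lebesgue[OF assms(1)]) simp
qed (use assms(3) in auto)

context oscillatory_kernel begin

text \<open>
  The beta kernel that is paired with $H(p/u)$; differentiating that pairing in $p$ produces
  $p^{s-1}$ times \<open>psi_kernel\<close>.
\<close>
definition weight :: "complex \<Rightarrow> complex \<Rightarrow> real \<Rightarrow> complex" where
  "weight x y t = of_real t powr (x + s - 1) * of_real (1 - t) powr (y + s - 1)"

lemma weight_eq_psi_kernel:
  assumes "p > 0" "t \<in> {0<..<1}"
  shows "weight x y t * (of_real (1 / (t * (1 - t))) * (of_real (p / (t * (1 - t))) powr (s - 1) * k (p / (t * (1 - t))))) =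
    of_real p powr (s - 1) * psi_kernel x y p t"
proof -
  define a where "a = complex_of_real t"
  define b where "b = complex_of_real (1 - t)"
  have t: "0 < t" "t < 1" using assms by auto
  have nz: "a \<noteq> 0" "b \<noteq> 0" using t unfolding a_def b_def of_real_eq_0_iff by auto
  have 1: "of_real (p / (t * (1 - t))) powr (s - 1) = of_real p powr (s - 1) * a powr (- (s - 1)) * b powr (- (s - 1))"
    unfolding a_def b_def using t assms by (intro of_real_quotient_powr) auto
  have 2: "c powr (x + s - 1) = c powr (x - 1) * c powr s" for c x
    using powr_add[of c "x - 1" s] by (simp add: algebra_simps)
  have 3: "c powr (- (s - 1)) = c / c powr s" if "c \<noteq> 0" for c
    using that powr_diff[of c 1 s] by simp
  have pn: "a powr s \<noteq> 0" "b powr s \<noteq> 0" using nz by auto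
  have 4: "complex_of_real (1 / (t * (1 - t))) = 1 / (a * b)" by (simp add: a_def b_def)
  have "(a powr (x - 1) * a powr s) * (b powr (y - 1) * b powr s) * (1 / (a * b) * (of_real p powr (s - 1) * (a / a powr s) * (b / b powr s) * k (p / (t * (1 - t)))))
     = of_real p powr (s - 1) * (a powr (x - 1) * b powr (y - 1) * k (p / (t * (1 - t))))"
    using nz pn by (simp add: field_simps)
  then show ?thesis
    unfolding weight_def psi_kernel_def 1 4 a_def[symmetric] b_def[symmetric] 2 3[OF nz(1)] 3[OF nz(2)] .
qed

lemma continuous_on_weight: "continuous_on {0<..<1} (weight x y)"
  unfolding weight_def[abs_def]
  by (intro continuous_on_mult continuous_on_of_real_powr) (auto intro!: continuous_intros)

lemma continuous_on_H: "continuous_on {0<..} H"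
  by (rule continuous_at_imp_continuous_on) (auto intro: has_vector_derivative_continuous[OF H_deriv])

lemma norm_weight: "t \<in> {0<..<1} \<Longrightarrow> norm (weight x y t) = t powr (Re (x + s) - 1) * (1 - t) powr (Re (y + s) - 1)"
  using norm_of_real_powr[of t] norm_of_real_powr[of "1 - t"] by (simp add: weight_def norm_mult)

text \<open>
  The antiderivative of the integrand is $K(p) = \int_0^1 \mathrm{weight}(t)\,g(t)\,H(p/u)\,dt$.
  The limits of $K$ at $0$ and at infinity follow from the limits of $H$ by dominated convergence.
  Its derivative is obtained from the truncated integrals, whose derivatives converge uniformly
  near every $p > 0$.
\<close>
theorem has_integral_mellin_kernel:
  assumes lim0: "(H \<longlongrightarrow> 0) (at_right 0)" and lim_top: "(H \<longlongrightarrow> L) at_top"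
    and X: "Re (x + s) > 0" and Y: "Re (y + s) > 0" and g: "C1_bound g A"
  shows "((\<lambda>p. of_real p powr (s - 1) * integral {0<..<1} (\<lambda>t. psi_kernel x y p t * g t)) has_integral
    (L * integral {0<..<1} (\<lambda>t. weight x y t * g t))) {0<..}"
proof -
  define \<phi> where "\<phi> t = weight x y t * g t" for t
  define f0 where "f0 t = A * M * (t powr (Re (x + s) - 1) * (1 - t) powr (Re (y + s) - 1))" for t
  define f1 where "f1 t = A * (t powr (Re (x + s) - 1) * (1 - t) powr (Re (y + s) - 1))" for t
  note A0 = C1_bound_nonneg[OF g]
  have int_f0: "f0 integrable_on {0<..<1}"
    unfolding f0_def[abs_def] using has_integral_mult_right[OF integrable_integral[OF real_beta_integrable[OF X Y]]] by blast
  have int_f1: "f1 integrable_on {0<..<1}"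
    unfolding f1_def[abs_def] using has_integral_mult_right[OF integrable_integral[OF real_beta_integrable[OF X Y]]] by blast
  have c\<phi>: "continuous_on {0<..<1} \<phi>"
    unfolding \<phi>_def[abs_def] by (intro continuous_on_mult continuous_on_weight C1_bound_continuous_on[OF g])
  have \<phi>_le: "norm (\<phi> t) \<le> f1 t" if "t \<in> {0<..<1}" for t
  proof -
    have "norm (g t) \<le> A" using g that unfolding C1_bound_def by blast
    then have "norm (weight x y t) * norm (g t) \<le> norm (weight x y t) * A" by (intro mult_left_mono) auto
    then show ?thesis unfolding \<phi>_def norm_mult f1_def norm_weight[OF that, symmetric] by (simp add: mult.commute)
  qed
  \<comment> \<open>Extending \<open>H\<close> by zero makes the domination hold for every real \<open>p\<close> and gives \<open>K 0 = 0\<close>.\<close>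
  define H0 where "H0 v = (if v > 0 then H v else 0)" for v
  have H0: "norm (H0 v) \<le> M" for v using H_bound M_nonneg by (simp add: H0_def)
  have le_f0: "norm (\<phi> t * H0 v) \<le> f0 t" if "t \<in> {0<..<1}" for t v
  proof -
    have "norm (\<phi> t) * norm (H0 v) \<le> f1 t * M"
      using \<phi>_le[OF that] H0[of v] by (intro mult_mono) (auto intro: order_trans[OF norm_ge_zero])
    then show ?thesis by (simp add: norm_mult f0_def f1_def mult_ac)
  qed
  define u where "u t = t * (1 - t)" for t :: real
  have u: "u t > 0" if "t \<in> {0<..<1}" for t using that by (simp add: u_def)
  define F where "F p t = \<phi> t * H0 (p / u t)" for p t
  define K where "K p = integral {0<..<1} (F p)" for p
  have cF: "continuous_on {0<..<1} (F p)" if "p > 0" for p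
  proof -
    have "continuous_on {0<..<1} (\<lambda>t. p / u t)"
      unfolding u_def by (intro continuous_intros) auto
    then have "continuous_on {0<..<1} (\<lambda>t. H (p / u t))"
      by (rule continuous_on_compose2[OF continuous_on_H]) (use u that in auto)
    then have "continuous_on {0<..<1} (\<lambda>t. \<phi> t * H (p / u t))" by (rule continuous_on_mult[OF c\<phi>])
    then show ?thesis by (rule continuous_on_eq) (use u that in \<open>auto simp: F_def H0_def\<close>)
  qed
  have int_F: "F p integrable_on {0<..<1}" for p
  proof (cases "p > 0")
    case True
    show ?thesis
      by (rule integrable_continuous_dominated[OF cF[OF True] int_f0]) (simp add: F_def le_f0)
  next
    case False
    have "((\<lambda>_. 0) has_integral 0) {0<..<1}" by simp
    then have "(F p has_integral 0) {0<..<1}"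
    proof (rule has_integral_eq[rotated])
      fix t :: real assume "t \<in> {0<..<1}"
      from u[OF this] False have "\<not> p / u t > 0" by (simp add: zero_less_divide_iff)
      then show "0 = F p t" by (simp add: F_def H0_def)
    qed
    then show ?thesis by blast
  qed
  have int_\<phi>: "\<phi> integrable_on {0<..<1}"
    by (rule integrable_continuous_dominated[OF c\<phi> int_f1 \<phi>_le])
  have K0: "K 0 = 0" unfolding K_def F_def H0_def by simp
  have K_lim: "(\<lambda>n. K (P n)) \<longlonglongrightarrow> integral {0<..<1} (\<lambda>t. \<phi> t * l)"
    if conv: "\<And>t. t \<in> {0<..<1} \<Longrightarrow> (\<lambda>n. H0 (P n / u t)) \<longlonglongrightarrow> l" for P l
    unfolding K_def
  proof (rule dominated_convergence(2)[OF int_F int_f0])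
    show "norm (F (P n) t) \<le> f0 t" if "t \<in> {0<..<1}" for n t by (simp add: F_def le_f0[OF that])
    show "(\<lambda>n. F (P n) t) \<longlonglongrightarrow> \<phi> t * l" if "t \<in> {0<..<1}" for t
      unfolding F_def by (rule tendsto_mult[OF tendsto_const conv[OF that]])
  qed
  have K_top: "(K \<longlongrightarrow> L * integral {0<..<1} \<phi>) at_top"
  proof (rule tendsto_at_topI_sequentially)
    fix P :: "nat \<Rightarrow> real" assume P: "filterlim P at_top sequentially"
    have H0_top: "(H0 \<longlongrightarrow> L) at_top"
      by (rule Lim_transform_eventually[OF lim_top])
         (rule eventually_mono[OF eventually_gt_at_top[of 0]], simp add: H0_def)
    have "(\<lambda>n. K (P n)) \<longlonglongrightarrow> integral {0<..<1} (\<lambda>t. \<phi> t * L)"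
    proof (rule K_lim)
      fix t :: real assume "t \<in> {0<..<1}"
      then have "filterlim (\<lambda>n. inverse (u t) * P n) at_top sequentially"
        using u by (intro filterlim_tendsto_pos_mult_at_top[OF tendsto_const _ P]) simp
      then have "filterlim (\<lambda>n. P n / u t) at_top sequentially" by (simp add: divide_inverse mult.commute)
      then show "(\<lambda>n. H0 (P n / u t)) \<longlonglongrightarrow> L" by (rule filterlim_compose[OF H0_top])
    qed
    then show "(\<lambda>n. K (P n)) \<longlonglongrightarrow> L * integral {0<..<1} \<phi>" by (simp add: mult.commute)
  qed
  have K_0: "(K \<longlongrightarrow> K 0) (at_right 0)"
  proof (rule tendsto_at_right_sequentially[of 0 1])
    fix P :: "nat \<Rightarrow> real" assume P: "\<And>n. 0 < P n" "P \<longlonglongrightarrow> 0"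
    have H0_0: "(H0 \<longlongrightarrow> 0) (at_right 0)"
      by (rule Lim_transform_eventually[OF lim0]) (simp add: H0_def eventually_at_filter)
    have "(\<lambda>n. K (P n)) \<longlonglongrightarrow> integral {0<..<1} (\<lambda>t. \<phi> t * 0)"
    proof (rule K_lim)
      fix t :: real assume t: "t \<in> {0<..<1}"
      have "(\<lambda>n. P n / u t) \<longlonglongrightarrow> 0 / u t" using u[OF t] by (intro tendsto_divide P tendsto_const) auto
      moreover have "0 < P n / u t" for n using P(1) u[OF t] by simp
      ultimately have "filterlim (\<lambda>n. P n / u t) (at_right 0) sequentially"
        by (intro tendsto_imp_filterlim_at_right always_eventually allI) simp_all
      then show "(\<lambda>n. H0 (P n / u t)) \<longlonglongrightarrow> 0" by (rule filterlim_compose[OF H0_0])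
    qed
    then show "(\<lambda>n. K (P n)) \<longlonglongrightarrow> K 0" by (simp add: K0)
  qed simp
  define I where "I p = of_real p powr (s - 1) * integral {0<..<1} (\<lambda>t. psi_kernel x y p t * g t)" for p
  obtain \<sigma> :: "real \<Rightarrow> real" where \<sigma>: "\<And>p. p > 0 \<Longrightarrow> C1_functional (psi_kernel x y p) (\<lambda>e. p powr - Re s * \<sigma> e)"
    "(\<sigma> \<longlongrightarrow> 0) (at_right 0)" "\<And>e. 0 \<le> \<sigma> e"
    by (rule psi_kernel_C1_functional[OF X Y], rule that)
  have K_deriv: "(K has_vector_derivative I p0) (at p0)" if p0: "p0 > 0" for p0
  proof -
    \<comment> \<open>On \<open>S\<close> the factor \<open>1 / p\<close> in the truncation error is at most \<open>2 / p0\<close>.\<close>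
    define S where "S = {p0/2<..<2*p0}"
    have S: "p0 \<in> S" "convex S" "open S" "\<And>p. p \<in> S \<Longrightarrow> p > 0" "\<And>p. p \<in> S \<Longrightarrow> p0 / 2 < p"
      using p0 by (auto simp: S_def)
    define Kn where "Kn n p = integral {cutoff n..1 - cutoff n} (F p)" for n p
    define In where "In n p = of_real p powr (s - 1) * integral {cutoff n..1 - cutoff n} (\<lambda>t. psi_kernel x y p t * g t)" for n p
    have sub: "{cutoff n..1 - cutoff n} \<subseteq> {0<..<1}" for n using cutoff_bounds[of n] by auto
    have Kn_deriv: "(Kn n has_vector_derivative In n p) (at p within S)" if p: "p \<in> S" for n p
    proof -
      have "((\<lambda>p. integral (cbox (cutoff n) (1 - cutoff n)) (F p)) has_vector_derivative 
         integral (cbox (cutoff n) (1 - cutoff n)) (\<lambda>t. of_real p powr (s - 1) * (psi_kernel x y p t * g t))) (at p within S)"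
      proof (rule leibniz_rule_vector_derivative[OF _ _ _ p S(2)])
        fix p t assume p: "p \<in> S" and "t \<in> cbox (cutoff n) (1 - cutoff n)"
        then have t: "t \<in> {0<..<1}" using sub[of n] by auto
        have pu: "p / u t > 0" using S(4)[OF p] u[OF t] by simp
        have "((\<lambda>p. p / u t) has_vector_derivative 1 / u t) (at p)"
          using u[OF t] by (auto simp: has_real_derivative_iff_has_vector_derivative[symmetric] intro!: derivative_eq_intros)
        from vector_diff_chain_at[OF this H_deriv[OF pu]]
        have "((\<lambda>p. H (p / u t)) has_vector_derivative of_real (1 / u t) * (of_real (p / u t) powr (s - 1) * k (p / u t))) (at p)"
          by (simp add: o_def scaleR_conv_of_real)
        then have "((\<lambda>p. \<phi> t * H (p / u t)) has_vector_derivative \<phi> t * (of_real (1 / u t) * (of_real (p / u t) powr (s - 1) * k (p / u t)))) (at p)"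
          by (rule has_vector_derivative_mult_right)
        moreover have "\<phi> t * (of_real (1 / u t) * (of_real (p / u t) powr (s - 1) * k (p / u t))) = of_real p powr (s - 1) * (psi_kernel x y p t * g t)"
          using arg_cong[OF weight_eq_psi_kernel[OF S(4)[OF p] t, of x y], of "\<lambda>c. c * g t"]
          unfolding \<phi>_def u_def by (simp only: mult_ac)
        ultimately have "((\<lambda>p. \<phi> t * H (p / u t)) has_vector_derivative of_real p powr (s - 1) * (psi_kernel x y p t * g t)) (at p)"
          by (simp only:)
        then have "((\<lambda>p. F p t) has_vector_derivative of_real p powr (s - 1) * (psi_kernel x y p t * g t)) (at p)"
          by (rule has_vector_derivative_transform_within_open[OF _ S(3) p])
             (use S(4) u[OF t] in \<open>auto simp: F_def H0_def\<close>)
        then show "((\<lambda>p. F p t) has_vector_derivative of_real p powr (s - 1) * (psi_kernel x y p t * g t)) (at p within S)"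
          by (rule has_vector_derivative_at_within)
      next
        fix p assume "p \<in> S"
        show "F p integrable_on cbox (cutoff n) (1 - cutoff n)"
          unfolding cbox_interval
          by (rule integrable_on_subinterval[OF int_F[of p, folded integrable_on_Icc_iff_Ioo]]) (use cutoff_bounds[of n] in auto)
      next
        have 1: "continuous_on (S \<times> {cutoff n..1 - cutoff n}) (\<lambda>z. of_real (fst z) powr (s - 1))"
          by (rule continuous_on_of_real_powr) (auto intro!: continuous_intros dest: S(4))
        have 2: "continuous_on (S \<times> {cutoff n..1 - cutoff n}) (\<lambda>z. psi_kernel x y (fst z) (snd z))"
          unfolding psi_kernel_def
        proof (intro continuous_on_mult continuous_on_of_real_powr continuous_on_compose2[OF cont_k])
          show "continuous_on (S \<times> {cutoff n..1 - cutoff n}) (\<lambda>z. fst z / (snd z * (1 - snd z)))"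
            by (intro continuous_intros) (use sub[of n] in force)
          show "(\<lambda>z. fst z / (snd z * (1 - snd z))) ` (S \<times> {cutoff n..1 - cutoff n}) \<subseteq> {0<..}"
            using sub[of n] S(4) by (auto intro!: divide_pos_pos mult_pos_pos)
        qed (use sub[of n] in \<open>auto intro!: continuous_intros\<close>)
        have 3: "continuous_on (S \<times> {cutoff n..1 - cutoff n}) (\<lambda>z. g (snd z))"
          by (rule continuous_on_compose2[OF C1_bound_continuous_on[OF g]]) (use sub[of n] in \<open>auto intro!: continuous_intros\<close>)
        show "continuous_on (S \<times> cbox (cutoff n) (1 - cutoff n)) (\<lambda>(p, t). of_real p powr (s - 1) * (psi_kernel x y p t * g t))"
          unfolding case_prod_unfold cbox_interval by (intro continuous_on_mult 1 2 3)
      qed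
      then show ?thesis by (simp add: Kn_def[abs_def] In_def)
    qed
    have "\<exists>G. \<forall>p\<in>S. (\<lambda>n. Kn n p) \<longlonglongrightarrow> G p \<and> (G has_derivative (\<lambda>h. h *\<^sub>R I p)) (at p within S)"
    proof (rule has_derivative_sequence[OF S(2), where f' = "\<lambda>n p h. h *\<^sub>R In n p"])
      show "(Kn n has_derivative (\<lambda>h. h *\<^sub>R In n p)) (at p within S)" if "p \<in> S" for n p
        using Kn_deriv[OF that] by (simp add: has_vector_derivative_def)
      show "p0 \<in> S" by (rule S(1))
      show "(\<lambda>n. Kn n p0) \<longlonglongrightarrow> K p0"
        unfolding Kn_def K_def
        by (rule filterlim_compose[OF truncated_integral_tendsto[OF int_F] cutoff_at_right_0])
      fix e :: real assume e: "e > 0"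
      have "(\<lambda>n. 4 * A / p0 * \<sigma> (cutoff n)) \<longlonglongrightarrow> 4 * A / p0 * 0"
        by (intro tendsto_mult tendsto_const filterlim_compose[OF \<sigma>(2) cutoff_at_right_0])
      then have "(\<lambda>n. 4 * A / p0 * \<sigma> (cutoff n)) \<longlonglongrightarrow> 0" by simp
      then have "\<forall>\<^sub>F n in sequentially. 4 * A / p0 * \<sigma> (cutoff n) < e" by (rule order_tendstoD) (rule e)
      then show "\<forall>\<^sub>F n in sequentially. \<forall>p\<in>S. \<forall>h. norm (h *\<^sub>R In n p - h *\<^sub>R I p) \<le> e * norm h"
      proof eventually_elim
        case (elim n)
        show ?case
        proof (intro ballI allI)
          fix p h assume p: "p \<in> S"
          interpret C1_functional "psi_kernel x y p" "\<lambda>e. p powr - Re s * \<sigma> e" by (rule \<sigma>(1)[OF S(4)[OF p]])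
          have "norm (In n p - I p) = p powr (Re s - 1) * norm (integral {0<..<1} (\<lambda>t. psi_kernel x y p t * g t) - integral {cutoff n..1 - cutoff n} (\<lambda>t. psi_kernel x y p t * g t))"
            unfolding In_def I_def right_diff_distrib[symmetric] norm_mult
            using norm_of_real_powr[OF S(4)[OF p], of "s - 1"] by (simp add: norm_minus_commute)
          also have "\<dots> \<le> p powr (Re s - 1) * (2 * (A * (p powr - Re s * \<sigma> (cutoff n))))"
            by (intro mult_left_mono truncation(2)[OF g] cutoff_bounds) auto
          also have "\<dots> = (p powr (Re s - 1) * p powr - Re s) * (2 * A * \<sigma> (cutoff n))" by (simp add: mult_ac)
          also have "p powr (Re s - 1) * p powr - Re s = 1 / p"
            using S(4)[OF p] by (simp add: powr_diff powr_minus_divide)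
          also have "1 / p * (2 * A * \<sigma> (cutoff n)) \<le> 1 / (p0 / 2) * (2 * A * \<sigma> (cutoff n))"
            using S(5)[OF p] p0 A0 \<sigma>(3) by (intro mult_right_mono divide_left_mono) auto
          also have "\<dots> \<le> e" using elim by (simp add: field_simps)
          finally have "norm (In n p - I p) \<le> e" .
          then have "\<bar>h\<bar> * norm (In n p - I p) \<le> \<bar>h\<bar> * e" by (intro mult_left_mono) auto
          then show "norm (h *\<^sub>R In n p - h *\<^sub>R I p) \<le> e * norm h"
            by (simp add: scaleR_diff_right[symmetric] mult.commute)
        qed
      qed
    qed
    then obtain G where G: "\<And>p. p \<in> S \<Longrightarrow> (\<lambda>n. Kn n p) \<longlonglongrightarrow> G p"
      "\<And>p. p \<in> S \<Longrightarrow> (G has_vector_derivative I p) (at p within S)"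
      unfolding has_vector_derivative_def by blast
    have GK: "G p = K p" if "p \<in> S" for p
    proof (rule LIMSEQ_unique[OF G(1)[OF that]])
      show "(\<lambda>n. Kn n p) \<longlonglongrightarrow> K p"
        unfolding Kn_def K_def
        by (rule filterlim_compose[OF truncated_integral_tendsto[OF int_F] cutoff_at_right_0])
    qed
    have "(G has_vector_derivative I p0) (at p0)"
      using G(2)[OF S(1)] by (simp add: at_within_open[OF S(1) S(3)])
    then show ?thesis
      by (rule has_vector_derivative_transform_within_open[OF _ S(3) S(1) GK])
  qed
  have "(I has_integral (L * integral {0<..<1} \<phi> - K 0)) {0<..}"
  proof (rule has_integral_Ioi_FTC[OF _ K_deriv K_top])
    show "continuous_on {0..} K"
      unfolding continuous_on_eq_continuous_within
    proof
      fix p :: real assume "p \<in> {0..}"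
      show "continuous (at p within {0..}) K"
      proof (cases "p = 0")
        case True
        then show ?thesis using K_0 by (simp add: continuous_within at_within_Ici_at_right)
      next
        case False
        then have "p > 0" using \<open>p \<in> {0..}\<close> by simp
        then show ?thesis
          by (rule continuous_at_imp_continuous_at_within[OF has_vector_derivative_continuous[OF K_deriv]])
      qed
    qed
  qed
  then show ?thesis by (simp add: I_def[abs_def] \<phi>_def[abs_def] K0)
qed

end

text \<open>
  The Psi-beta functions in the defining series are the moments of \<open>psi_kernel\<close>, so the series is
  the binomial transform of that kernel.
\<close>
lemma (in oscillatory_kernel) psi_hypergeo_integral:
  assumes k: "\<And>v. k v = wright_psi \<alpha> \<beta> (- of_real v)"
    and X: "Re (b + s) > 0" and Y: "Re (c - b + s) > 0" and z: "z \<in> cut_plane" and p: "p > 0"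
  shows "psi_hypergeo \<alpha> \<beta> (of_real p) a b c z =
    1 / Beta b (c - b) * integral {0<..<1} (\<lambda>t. psi_kernel b (c - b) p t * (1 - z * of_real t) powr (- a))"
proof -
  obtain \<sigma> :: "real \<Rightarrow> real" where \<sigma>: "\<And>p. p > 0 \<Longrightarrow> C1_functional (psi_kernel b (c - b) p) (\<lambda>e. p powr - Re s * \<sigma> e)"
    by (rule psi_kernel_C1_functional[OF X Y], rule that)
  interpret C1: C1_functional "psi_kernel b (c - b) p" "\<lambda>e. p powr - Re s * \<sigma> e" by (rule \<sigma>[OF p])
  have "psi_beta \<alpha> \<beta> (of_real p) (b + of_nat n) (c - b) = integral {0<..<1} (\<lambda>t. psi_kernel b (c - b) p t * of_real t ^ n)" for n
    unfolding psi_beta_def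
  proof (rule integral_cong)
    fix t :: real assume t: "t \<in> {0<..<1}"
    have "- complex_of_real p / of_real (t * (1 - t)) = - of_real (p / (t * (1 - t)))" by simp
    then show "of_real t powr (b + of_nat n - 1) * of_real (1 - t) powr (c - b - 1) *
          wright_psi \<alpha> \<beta> (- of_real p / of_real (t * (1 - t))) = psi_kernel b (c - b) p t * of_real t ^ n"
      using t unfolding psi_kernel_def k by (simp only: of_real_powr_add_nat greaterThanLessThan_iff mult_ac)
  qed
  then have "(\<lambda>n. pochhammer a n * (psi_beta \<alpha> \<beta> (of_real p) (b + of_nat n) (c - b) / Beta b (c - b)) / fact n) =
      (\<lambda>n. pochhammer a n / fact n * (1 / Beta b (c - b) * integral {0<..<1} (\<lambda>t. psi_kernel b (c - b) p t * of_real t ^ n)))"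
    by (simp add: fun_eq_iff)
  then show ?thesis
    unfolding psi_hypergeo_def by (simp only: C1.cut_continuation_binomial_transform[OF z])
qed

theorem theorem3p5:
  fixes \<alpha> \<beta> a b c z s :: complex
  assumes "Re \<alpha> > -1"
    and "Re c > Re b" and "Re b > 0"
    and "z \<noteq> 1" and "\<bar>Arg (1 - z)\<bar> < pi"
    and "Re s > 0"
    and "(\<lambda>v::real. of_real v powr (s - 1) * wright_psi \<alpha> \<beta> (- of_real v)) integrable_on {0<..}"
  shows "(\<lambda>p::real. of_real p powr (s - 1) * psi_hypergeo \<alpha> \<beta> (of_real p) a b c z)
           integrable_on {0<..} \<and>
         mellin (\<lambda>p. psi_hypergeo \<alpha> \<beta> (of_real p) a b c z) s =
           psi_gamma \<alpha> \<beta> 0 s * Beta (b + s) (c + s - b) / Beta b (c - b) *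
             gauss_hypergeo a (b + s) (c + 2 * s) z"
proof -
  define k where "k v = wright_psi \<alpha> \<beta> (- of_real v)" for v
  define h where "h v = of_real v powr (s - 1) * k v" for v
  define L where "L = integral {0<..} h"
  have z: "z \<in> cut_plane" using assms(4,5) by (simp add: cut_plane_def)
  have X: "Re (b + s) > 0" and Y: "Re (c - b + s) > 0" using assms by auto
  have cont_k: "continuous_on {0<..} k"
    unfolding k_def[abs_def]
    by (rule continuous_on_compose2[OF continuous_on_wright_psi[OF assms(1)]]) (auto intro!: continuous_intros)
  have cont_h: "continuous_on {0<..} h"
    unfolding h_def[abs_def] by (intro continuous_on_mult cont_k continuous_on_of_real_powr continuous_on_id) auto
  have has_L: "(h has_integral L) {0<..}"
    unfolding L_def using assms(7) by (simp add: h_def[abs_def] k_def integrable_integral)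
  obtain M where M: "M > 0" "\<And>v. v > 0 \<Longrightarrow> norm (integral {0..v} h) \<le> M"
    "\<And>v. v > 0 \<Longrightarrow> ((\<lambda>v. integral {0..v} h) has_vector_derivative h v) (at v)"
    "((\<lambda>v. integral {0..v} h) \<longlongrightarrow> 0) (at_right 0)" "((\<lambda>v. integral {0..v} h) \<longlongrightarrow> L) at_top"
    by (rule bounded_primitive_of_improper_integrable[OF has_L cont_h]) (rule that)
  interpret oscillatory_kernel k "\<lambda>v. integral {0..v} h" s M
    by unfold_locales (use cont_k M(2,3) in \<open>auto simp: h_def\<close>)
  obtain A where A: "C1_bound (\<lambda>t. (1 - z * of_real t) powr (- a)) A"
    using C1_bound_binomial_kernel[of "{z}" "- a"] z by auto
  define E where "E = integral {0<..<1} (\<lambda>t. weight b (c - b) t * (1 - z * of_real t) powr (- a))"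
  have E: "E = Beta (b + s) (c + s - b) * gauss_hypergeo a (b + s) (c + 2 * s) z"
    using gauss_hypergeo_Euler_integral[OF X Y z, of a] by (simp add: E_def weight_def algebra_simps)
  have "((\<lambda>p. 1 / Beta b (c - b) * (of_real p powr (s - 1) *
      integral {0<..<1} (\<lambda>t. psi_kernel b (c - b) p t * (1 - z * of_real t) powr (- a)))) has_integral (1 / Beta b (c - b) * (L * E))) {0<..}"
    unfolding E_def by (rule has_integral_mult_right[OF has_integral_mellin_kernel[OF M(4,5) X Y A]])
  then have I: "((\<lambda>p. of_real p powr (s - 1) * psi_hypergeo \<alpha> \<beta> (of_real p) a b c z) has_integral
      (1 / Beta b (c - b) * (L * E))) {0<..}"
    by (rule has_integral_eq[rotated]) (simp add: psi_hypergeo_integral[OF k_def X Y z])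
  have "psi_gamma \<alpha> \<beta> 0 s = L"
    by (simp add: psi_gamma_def L_def h_def[abs_def] k_def)
  with I show ?thesis
    unfolding mellin_def by (auto simp: integral_unique E)
qed

end
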